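(* There exists a recursive countable weakly transitive quasiminimal subshift $X \subset \{0,1\}^{\mathbb{Z}}$ for which the modular halting problem is $\Sigma^0_1$-complete, and which has exactly two nonempty proper subsystems, namely $\mathcal{L}^{-1}(0^*10^* )$ and $\mathcal{L}^{-1}(0^* )$.
   Context: For a finite alphabet $S$, give $S^{\mathbb{Z}}$ the product topology and the shift $\sigma(x)_i = x_{i+1}$. A subshift is a closed set $X \subset S^{\mathbb{Z}}$ with $\sigma(X)=X$; a subsystem of $X$ is a subshift $Y \subset X$. $X$ is quasiminimal if it has finitely many proper subshifts. The language $\mathcal{L}(X)$ is the set of finite words occurring as contiguous subwords of points of $X$; $X$ is recursive if $\mathcal{L}(X)$ is recursive. $X$ is weakly transitive if some point $x \in X$ contains every word of $\mathcal{L}(X)$. For an extendable language $L\subset S^*$, $\mathcal{L}^{-1}(L)$ is the unique subshift whose language is the set of all contiguous subwords of words of $L$; thus $\mathcal{L}^{-1}(0^* )$ consists of the single point $0^{\mathbb{Z}}$ and $\mathcal{L}^{-1}(0^*10^* )$ is the set of points of $\{0,1\}^{\mathbb{Z}}$ with at most one occurrence of $1$. For a finite set $C$ of words of a common length $n$, $[C]$ is the clopen set of points $x$ with $x_{[0,n-1]} \in C$; clopen sets are given in such a finite form (up to a shift of coordinates). The modular halting problem for $X$ is: given clopen sets $[C],[D]$ and numbers $k,m$, decide whether there exist $x \in X$ and $j \in \mathbb{N}=\{0,1,2,\dots\}$ with $j \equiv k \bmod m$, $x \in [C]$ and $\sigma^j(x) \in [D]$. Completeness is under many-one reductions. *)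

theory Defs
  imports
    "HOL-Analysis.Analysis"
    "HOL-Number_Theory.Cong"
    "HOL-Library.Sublist"
    "HOL-Library.Nat_Bijection"
begin

text \<open>
  \<open>general_recursive n f\<close>: Kleene's (total) general recursive functions of arity \<open>n\<close>, with
  minimisation restricted to regular functions. Only the values of \<open>f\<close> on argument lists of
  length \<open>n\<close> are meaningful. In primitive recursion and in minimisation the distinguished
  argument comes first.
\<close>

inductive general_recursive :: "nat \<Rightarrow> (nat list \<Rightarrow> nat) \<Rightarrow> bool" where
  zero: "general_recursive n (\<lambda>_. 0)"
| succ: "general_recursive 1 (\<lambda>xs. Suc (xs ! 0))"
| proj: "i < n \<Longrightarrow> general_recursive n (\<lambda>xs. xs ! i)"
| comp: "\<lbrakk>general_recursive (length gs) f; \<forall>g \<in> set gs. general_recursive n g\<rbrakk>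
    \<Longrightarrow> general_recursive n (\<lambda>xs. f (map (\<lambda>g. g xs) gs))"
| prec: "\<lbrakk>general_recursive n f; general_recursive (n + 2) g\<rbrakk>
    \<Longrightarrow> general_recursive (n + 1)
          (\<lambda>xs. rec_nat (f (tl xs)) (\<lambda>k r. g (k # r # tl xs)) (hd xs))"
| minim: "\<lbrakk>general_recursive (n + 1) f; \<forall>xs. length xs = n \<longrightarrow> (\<exists>y. f (y # xs) = 0)\<rbrakk>
    \<Longrightarrow> general_recursive n (\<lambda>xs. LEAST y. f (y # xs) = 0)"

definition recursive_fun :: "(nat \<Rightarrow> nat) \<Rightarrow> bool" where
  "recursive_fun f \<longleftrightarrow> (\<exists>F. general_recursive 1 F \<and> (\<forall>x. f x = F [x]))"

definition recursive_set :: "nat set \<Rightarrow> bool" where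
  "recursive_set A \<longleftrightarrow> recursive_fun (\<lambda>x. if x \<in> A then 1 else 0)"

definition Sigma01 :: "nat set \<Rightarrow> bool" where
  "Sigma01 A \<longleftrightarrow> (\<exists>F. general_recursive 2 F \<and> (\<forall>x. x \<in> A \<longleftrightarrow> (\<exists>y. F [x, y] = 0)))"

definition many_one_reducible :: "nat set \<Rightarrow> nat set \<Rightarrow> bool" where
  "many_one_reducible A B \<longleftrightarrow> (\<exists>f. recursive_fun f \<and> (\<forall>x. x \<in> A \<longleftrightarrow> f x \<in> B))"

definition Sigma01_complete :: "nat set \<Rightarrow> bool" where
  "Sigma01_complete A \<longleftrightarrow> Sigma01 A \<and> (\<forall>B. Sigma01 B \<longrightarrow> many_one_reducible B A)"

definition full_shift :: "'a set \<Rightarrow> (int \<Rightarrow> 'a) topology" where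
  "full_shift S = product_topology (\<lambda>_. discrete_topology S) UNIV"

definition shift_map :: "(int \<Rightarrow> 'a) \<Rightarrow> int \<Rightarrow> 'a" where
  "shift_map x = (\<lambda>i. x (i + 1))"

definition subshift :: "'a set \<Rightarrow> (int \<Rightarrow> 'a) set \<Rightarrow> bool" where
  "subshift S X \<longleftrightarrow> closedin (full_shift S) X \<and> shift_map ` X = X"

definition quasiminimal :: "'a set \<Rightarrow> (int \<Rightarrow> 'a) set \<Rightarrow> bool" where
  "quasiminimal S X \<longleftrightarrow> subshift S X \<and> finite {Y. subshift S Y \<and> Y \<subset> X}"

definition occurs_at :: "'a list \<Rightarrow> (int \<Rightarrow> 'a) \<Rightarrow> int \<Rightarrow> bool" where
  "occurs_at w x p \<longleftrightarrow> (\<forall>k < length w. x (p + int k) = w ! k)"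

definition language :: "(int \<Rightarrow> 'a) set \<Rightarrow> 'a list set" where
  "language X = {w. \<exists>x \<in> X. \<exists>p. occurs_at w x p}"

definition weakly_transitive :: "(int \<Rightarrow> 'a) set \<Rightarrow> bool" where
  "weakly_transitive X \<longleftrightarrow> (\<exists>x \<in> X. \<forall>w \<in> language X. \<exists>p. occurs_at w x p)"

definition recursive_subshift :: "(int \<Rightarrow> nat) set \<Rightarrow> bool" where
  "recursive_subshift X \<longleftrightarrow> recursive_set (list_encode ` language X)"

text \<open>Meaningful for extendable \<open>L\<close> (so that such a subshift exists).\<close>

definition lang_inv :: "'a set \<Rightarrow> 'a list set \<Rightarrow> (int \<Rightarrow> 'a) set" where
  "lang_inv S L = (THE X. subshift S X \<and> language X = {u. \<exists>w \<in> L. sublist u w})"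

text \<open>
  A finite set of words of a common length is given by a list \<open>C\<close> enumerating it, and a clopen
  set by such a list together with the coordinate \<open>p\<close> at which the words are read: for \<open>p = 0\<close>,
  \<open>clopen_set (p, C)\<close> is the set \<open>[C]\<close>.
\<close>

type_synonym clopen_code = "int \<times> nat list list"

definition valid_clopen_code :: "nat set \<Rightarrow> clopen_code \<Rightarrow> bool" where
  "valid_clopen_code S c \<longleftrightarrow> (\<exists>n. \<forall>w \<in> set (snd c). length w = n \<and> set w \<subseteq> S)"

definition clopen_set :: "clopen_code \<Rightarrow> (int \<Rightarrow> nat) set" where
  "clopen_set c = {x. \<exists>w \<in> set (snd c). occurs_at w x (fst c)}"

fun encode_instance :: "clopen_code \<times> clopen_code \<times> nat \<times> nat \<Rightarrow> nat" where
  "encode_instance ((p, C), (q, D), k, m) =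
     list_encode [int_encode p, list_encode (map list_encode C),
                  int_encode q, list_encode (map list_encode D), k, m]"

text \<open>For \<open>m = 0\<close> the congruence amounts to \<open>j = k\<close>.\<close>

definition modular_halting_problem :: "nat set \<Rightarrow> (int \<Rightarrow> nat) set \<Rightarrow> nat set" where
  "modular_halting_problem S X =
     {encode_instance (c, d, k, m) | c d k m.
        valid_clopen_code S c \<and> valid_clopen_code S d \<and>
        (\<exists>x \<in> X. \<exists>j. [j = k] (mod m) \<and> x \<in> clopen_set c \<and> (shift_map ^^ j) x \<in> clopen_set d)}"

end

theory Submission
  imports Defs
begin

text \<open>
  The subshift is the orbit closure of a single bi-infinite sequence over \<open>{0, 1}\<close>, the generating
  point, whose 1s sit at the positions \<open>mark 0 < mark 1 < \<dots>\<close>.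

  Only two features of the marks matter for the dynamics (locale \<open>growing_gaps\<close>). As the gaps between
  consecutive marks increase strictly, a single gap determines its place, so a point of the orbit
  closure with at least two 1s is a shift of the generating point (\<open>orbit_closure_adjacent_ones\<close>).
  As the gaps tend to infinity, the points with at most one 1 all occur as limits. So the orbit
  closure is countable, a subsystem containing a shift of the generating point is everything, and
  what is left are the points with at most one 1 and the zero point
  (\<open>proper_subsystems_orbit_closure\<close>). If moreover the marks are computable, the language is
  recursive, because a word that occurs at all already occurs at a place bounded in terms of its length
  (\<open>language_orbit_closure_bounded\<close>).

  There remains the freedom to perturb the marks slightly, and this is used to write a
  \<open>\<Sigma>\<^sup>0\<^sub>1\<close>-complete set into them. Let \<open>accepts n w\<close> be a decidable predicate such that
  \<open>{n. \<exists>w. accepts n w}\<close> is complete. With \<open>t\<close> coding the pair \<open>(n, w)\<close> the mark is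
  \<open>mark t = 4\<^bsup>t+1\<^esup> + (if accepts n w then 2\<^bsup>n\<^esup> else 0)\<close>.
  Modulo \<open>2\<^bsup>n+1\<^esup>\<close> every mark with \<open>t \<ge> n\<close> loses its main term, and the only perturbation congruent to
  \<open>2\<^bsup>n\<^esup>\<close> is \<open>2\<^bsup>n\<^esup>\<close> itself. Hence some mark with \<open>t \<ge> n\<close> is congruent to \<open>2\<^bsup>n\<^esup>\<close> modulo \<open>2\<^bsup>n+1\<^esup>\<close> if and
  only if some \<open>w\<close> is accepted for \<open>n\<close> (\<open>visits_mark_iff\<close>). This is an instance of the modular halting
  problem: a fixed word containing the first two 1s pins down the point up to the choice of origin,
  which is placed after the marks with \<open>t < n\<close>, and the target is the cylinder of a single 1
  (\<open>halting_instance_iff\<close>). Conversely the problem is in \<open>\<Sigma>\<^sup>0\<^sub>1\<close> for every recursive subshift, since a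
  visit is witnessed by one word of the language (\<open>visit_iff_word\<close>).

  The complete set comes from a machine whose step function is recursive and which has a program
  for every general recursive function (\<open>every_recursive_function_has_program\<close>); \<open>accepts\<close> says that
  a given run halts with result 0 after a given number of steps.
\<close>

section \<open>General recursive functions up to their values on proper argument lists\<close>

text \<open>
  A derivation of \<open>general_recursive n f\<close> fixes \<open>f\<close> also on lists of other lengths than \<open>n\<close>, so
  this predicate does not respect equality of \<open>n\<close>-ary functions. Passing to \<open>rec_on\<close> repairs this.
\<close>

definition rec_on :: "nat \<Rightarrow> (nat list \<Rightarrow> nat) \<Rightarrow> bool" where
  "rec_on n f \<longleftrightarrow> (\<exists>F. general_recursive n F \<and> (\<forall>xs. length xs = n \<longrightarrow> f xs = F xs))"

lemma rec_on_cong: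
  assumes "rec_on n f" "\<And>xs. length xs = n \<Longrightarrow> g xs = f xs"
  shows "rec_on n g"
  using assms unfolding rec_on_def by metis

lemma rec_on_proj: "i < n \<Longrightarrow> rec_on n (\<lambda>xs. xs ! i)"
  unfolding rec_on_def using general_recursive.proj by blast

lemma rec_on_comp:
  assumes "rec_on (length gs) f" "\<forall>g \<in> set gs. rec_on n g"
  shows "rec_on n (\<lambda>xs. f (map (\<lambda>g. g xs) gs))"
proof -
  obtain F where F: "general_recursive (length gs) F" "\<forall>xs. length xs = length gs \<longrightarrow> f xs = F xs"
    using assms(1) unfolding rec_on_def by blast
  obtain G where G: "\<forall>g\<in>set gs. general_recursive n (G g) \<and> (\<forall>xs. length xs = n \<longrightarrow> g xs = G g xs)"
    using assms(2) unfolding rec_on_def by metis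
  have "general_recursive n (\<lambda>xs. F (map (\<lambda>g. g xs) (map G gs)))"
    using F(1) G by (intro general_recursive.comp) auto
  moreover have "f (map (\<lambda>g. g xs) gs) = F (map (\<lambda>g. g xs) (map G gs))" if "length xs = n" for xs
  proof -
    have "map (\<lambda>g. g xs) gs = map (\<lambda>g. g xs) (map G gs)"
      using G that by (simp add: comp_def)
    then show ?thesis using F(2) by (metis length_map)
  qed
  ultimately show ?thesis unfolding rec_on_def by blast
qed

lemma rec_on_comp1:
  assumes "rec_on 1 (\<lambda>xs. g (xs ! 0))" "rec_on n a"
  shows "rec_on n (\<lambda>xs. g (a xs))"
  using rec_on_comp[of "[a]" "\<lambda>xs. g (xs ! 0)" n] assms by simp

lemma rec_on_comp2:
  assumes "rec_on 2 (\<lambda>xs. g (xs ! 0) (xs ! 1))" "rec_on n a" "rec_on n b"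
  shows "rec_on n (\<lambda>xs. g (a xs) (b xs))"
  using rec_on_comp[of "[a, b]" "\<lambda>xs. g (xs ! 0) (xs ! 1)" n] assms[unfolded numeral_2_eq_2]
  by simp

lemma rec_on_Suc:
  assumes "rec_on n a" shows "rec_on n (\<lambda>xs. Suc (a xs))"
proof -
  have "rec_on 1 (\<lambda>xs. Suc (xs ! 0))"
    unfolding rec_on_def using general_recursive.succ by blast
  from rec_on_comp1[OF this assms] show ?thesis .
qed

lemma rec_on_const: "rec_on n (\<lambda>_. c)"
proof (induction c)
  case 0
  show ?case unfolding rec_on_def using general_recursive.zero by blast
qed (rule rec_on_Suc)

lemma rec_on_prec:
  assumes "rec_on n f" "rec_on (n + 2) g"
  shows "rec_on (n + 1) (\<lambda>xs. rec_nat (f (tl xs)) (\<lambda>k r. g (k # r # tl xs)) (hd xs))"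
proof -
  obtain F where F: "general_recursive n F" "\<forall>xs. length xs = n \<longrightarrow> f xs = F xs"
    using assms(1) unfolding rec_on_def by blast
  obtain G where G: "general_recursive (n + 2) G" "\<forall>xs. length xs = n + 2 \<longrightarrow> g xs = G xs"
    using assms(2) unfolding rec_on_def by blast
  have "rec_nat (f (tl xs)) (\<lambda>k r. g (k # r # tl xs)) m = rec_nat (F (tl xs)) (\<lambda>k r. G (k # r # tl xs)) m"
    if "length xs = n + 1" for xs m
    using F(2) G(2) that by (induction m) auto
  with general_recursive.prec[OF F(1) G(1)] show ?thesis
    unfolding rec_on_def by blast
qed

lemma rec_on_prec1:
  assumes "rec_on 2 (\<lambda>xs. g (xs ! 0) (xs ! 1))"
  shows "rec_on 1 (\<lambda>xs. rec_nat c g (xs ! 0))"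
proof -
  have *: "rec_on (0 + 1) (\<lambda>xs. rec_nat c (\<lambda>k r. g ((k # r # tl xs) ! 0) ((k # r # tl xs) ! 1)) (hd xs))"
    by (rule rec_on_prec) (use assms in \<open>simp_all add: rec_on_const numeral_2_eq_2\<close>)
  show ?thesis by (rule rec_on_cong[OF *[unfolded add_0]]) (auto simp: length_Suc_conv)
qed

lemma rec_on_prec2:
  assumes "rec_on 1 (\<lambda>xs. f (xs ! 0))" "rec_on 3 (\<lambda>xs. g (xs ! 0) (xs ! 1) (xs ! 2))"
  shows "rec_on 2 (\<lambda>xs. rec_nat (f (xs ! 1)) (\<lambda>k r. g k r (xs ! 1)) (xs ! 0))"
proof -
  have *: "rec_on (1 + 1) (\<lambda>xs. rec_nat (f (tl xs ! 0))
     (\<lambda>k r. g ((k # r # tl xs) ! 0) ((k # r # tl xs) ! 1) ((k # r # tl xs) ! 2)) (hd xs))"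
    by (rule rec_on_prec) (use assms in \<open>simp_all add: numeral_3_eq_3\<close>)
  show ?thesis by (rule rec_on_cong[OF *[unfolded one_add_one]]) (auto simp: numeral_2_eq_2 length_Suc_conv)
qed

lemma rec_on_least:
  assumes "rec_on 2 (\<lambda>xs. f (xs ! 0) (xs ! 1))" "\<And>x. \<exists>y. f y x = 0"
  shows "rec_on 1 (\<lambda>xs. LEAST y. f y (xs ! 0) = 0)"
proof -
  obtain F where F: "general_recursive 2 F" "\<And>xs. length xs = 2 \<Longrightarrow> f (xs ! 0) (xs ! 1) = F xs"
    using assms(1) unfolding rec_on_def by blast
  have FF: "f y (xs ! 0) = F (y # xs)" if "length xs = 1" for y xs
    using F(2)[of "y # xs"] that by simp
  have "general_recursive 1 (\<lambda>xs. LEAST y. F (y # xs) = 0)"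
    using F(1) FF assms(2) by (intro general_recursive.minim) (simp_all only: one_add_one, metis)
  with FF show ?thesis unfolding rec_on_def by (intro exI conjI) auto
qed

lemma rec_on_add2: "rec_on 2 (\<lambda>xs. xs ! 0 + xs ! 1)"
proof (rule rec_on_cong)
  show "rec_on 2 (\<lambda>xs. rec_nat (xs ! 1) (\<lambda>k r. Suc r) (xs ! 0))"
    by (rule rec_on_prec2) (simp_all add: rec_on_Suc rec_on_proj)
  have "rec_nat m (\<lambda>k. Suc) n = n + m" for m n by (induction n) auto
  then show "xs ! 0 + xs ! 1 = rec_nat (xs ! 1) (\<lambda>k. Suc) (xs ! 0)" for xs :: "nat list" by simp
qed

lemmas rec_on_add = rec_on_comp2[OF rec_on_add2]

lemma rec_on_pred1: "rec_on 1 (\<lambda>xs. xs ! 0 - 1)"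
proof (rule rec_on_cong)
  show "rec_on 1 (\<lambda>xs. rec_nat 0 (\<lambda>k r. k) (xs ! 0))"
    by (rule rec_on_prec1) (simp_all add: rec_on_proj)
  show "xs ! 0 - 1 = rec_nat 0 (\<lambda>k r. k) (xs ! 0)" for xs :: "nat list"
    by (cases "xs ! 0") auto
qed

lemma rec_on_diff2: "rec_on 2 (\<lambda>xs. xs ! 0 - xs ! 1)"
proof -
  have "rec_on 2 (\<lambda>xs. rec_nat (xs ! 1) (\<lambda>k r. r - 1) (xs ! 0))"
    by (rule rec_on_prec2) (intro rec_on_comp1[OF rec_on_pred1] rec_on_proj; simp)+
  from rec_on_comp2[OF this rec_on_proj[of 1 2] rec_on_proj[of 0 2]]
  have "rec_on 2 (\<lambda>xs. rec_nat (xs ! 0) (\<lambda>k r. r - 1) (xs ! 1))" by simp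
  moreover have "rec_nat m (\<lambda>k r. r - 1) n = m - n" for m n :: nat by (induction n) auto
  ultimately show ?thesis by simp
qed

lemmas rec_on_diff = rec_on_comp2[OF rec_on_diff2]

lemma rec_on_triangle1: "rec_on 1 (\<lambda>xs. triangle (xs ! 0))"
proof (rule rec_on_cong)
  show "rec_on 1 (\<lambda>xs. rec_nat 0 (\<lambda>k r. r + Suc k) (xs ! 0))"
    by (rule rec_on_prec1) (intro rec_on_add rec_on_Suc rec_on_proj; simp)
  have "triangle n = rec_nat 0 (\<lambda>k r. r + Suc k) n" for n by (induction n) auto
  then show "triangle (xs ! 0) = rec_nat 0 (\<lambda>k r. r + Suc k) (xs ! 0)" for xs :: "nat list" .
qed

lemmas rec_on_triangle = rec_on_comp1[OF rec_on_triangle1]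

abbreviation pair :: "nat \<Rightarrow> nat \<Rightarrow> nat" where "pair x y \<equiv> prod_encode (x, y)"

definition left :: "nat \<Rightarrow> nat" where "left z = fst (prod_decode z)"
definition right :: "nat \<Rightarrow> nat" where "right z = snd (prod_decode z)"

lemma left_pair [simp]: "left (pair x y) = x" by (simp add: left_def)
lemma right_pair [simp]: "right (pair x y) = y" by (simp add: right_def)
lemma pair_left_right [simp]: "pair (left z) (right z) = z" by (simp add: left_def right_def)
lemma pair_0_0 [simp]: "pair 0 0 = 0" by (simp add: prod_encode_def)
lemma right_0 [simp]: "right 0 = 0" by (metis right_pair pair_0_0)

lemma triangle_strict_mono: "strict_mono triangle"
  by (rule strict_mono_Suc_iff[THEN iffD2]) simp

text \<open>
  The sum of the projections is the index of the diagonal of the Cantor pairing on which a number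
  lies; an unbounded search finds it, and it determines both projections.
\<close>

lemma left_add_right: "left z + right z = (LEAST k. Suc z - triangle (Suc k) = 0)"
proof -
  obtain m n where z: "z = pair m n" by (metis pair_left_right)
  have "(LEAST k. Suc z - triangle (Suc k) = 0) = m + n"
  proof (rule Least_equality)
    fix k assume "Suc z - triangle (Suc k) = 0"
    then have "triangle (m + n) < triangle (Suc k)" by (simp add: z prod_encode_def)
    then show "m + n \<le> k" using strict_mono_less[OF triangle_strict_mono] by (metis less_Suc_eq_le)
  qed (simp add: z prod_encode_def)
  then show ?thesis by (simp add: z)
qed

lemma left_eq: "left z = z - triangle (left z + right z)"
proof -
  obtain m n where z: "z = pair m n" by (metis pair_left_right)
  show ?thesis by (simp add: z) (simp add: prod_encode_def)
qed

lemma rec_on_left_add_right: "rec_on 1 (\<lambda>xs. left (xs ! 0) + right (xs ! 0))"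
  unfolding left_add_right
proof (rule rec_on_least)
  show "rec_on 2 (\<lambda>xs. Suc (xs ! 1) - triangle (Suc (xs ! 0)))"
    by (intro rec_on_diff rec_on_Suc rec_on_triangle rec_on_proj; simp)
  show "\<exists>y. Suc x - triangle (Suc y) = 0" for x
    by (rule exI[of _ x]) simp
qed

lemma rec_on_left1: "rec_on 1 (\<lambda>xs. left (xs ! 0))"
  by (subst left_eq) (intro rec_on_diff rec_on_triangle rec_on_left_add_right rec_on_proj; simp)

lemma rec_on_right1: "rec_on 1 (\<lambda>xs. right (xs ! 0))"
proof -
  have "rec_on 1 (\<lambda>xs. left (xs ! 0) + right (xs ! 0) - left (xs ! 0))"
    by (intro rec_on_diff rec_on_left_add_right rec_on_left1)
  then show ?thesis by simp
qed

lemma rec_on_pair2: "rec_on 2 (\<lambda>xs. pair (xs ! 0) (xs ! 1))"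
  unfolding prod_encode_def prod.case
  by (intro rec_on_add rec_on_triangle rec_on_proj; simp)

section \<open>Recursive functions of one packed argument\<close>

text \<open>
  From here on several arguments are packed into one number by \<open>pair\<close>. All functions are then terms
  in one free variable, and the rules collected in \<open>rec_intros\<close> decompose such a term along its
  syntax: the rules for recursion, search and quantification replace the bound variables by
  projections of the packed variable.
\<close>

lemma recursive_fun_iff: "recursive_fun f \<longleftrightarrow> rec_on 1 (\<lambda>xs. f (xs ! 0))"
proof
  assume "recursive_fun f"
  then obtain F where F: "general_recursive 1 F" "\<And>x. f x = F [x]"
    unfolding recursive_fun_def by blast
  have "f (xs ! 0) = F xs" if "length xs = 1" for xs
    using that F(2) by (cases xs) auto
  with F(1) show "rec_on 1 (\<lambda>xs. f (xs ! 0))" unfolding rec_on_def by blast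
next
  assume "rec_on 1 (\<lambda>xs. f (xs ! 0))"
  then obtain F where "general_recursive 1 F" "\<forall>xs. length xs = 1 \<longrightarrow> f (xs ! 0) = F xs"
    unfolding rec_on_def by blast
  moreover from this(2) have "f x = F [x]" for x by (elim allE[of _ "[x]"]) simp
  ultimately show "recursive_fun f" unfolding recursive_fun_def by blast
qed

named_theorems rec_intros

lemma recursive_fun_comp: "recursive_fun f \<Longrightarrow> recursive_fun g \<Longrightarrow> recursive_fun (\<lambda>x. f (g x))"
  unfolding recursive_fun_iff by (rule rec_on_comp1)

lemma recursive_fun_const [rec_intros]: "recursive_fun (\<lambda>_. c)"
  unfolding recursive_fun_iff by (rule rec_on_const)

lemma recursive_fun_id [rec_intros]: "recursive_fun (\<lambda>x. x)"
  unfolding recursive_fun_iff by (rule rec_on_proj) simp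

lemma recursive_fun_Suc [rec_intros]: "recursive_fun a \<Longrightarrow> recursive_fun (\<lambda>x. Suc (a x))"
  unfolding recursive_fun_iff by (rule rec_on_Suc)

lemma recursive_fun_pair [rec_intros]:
  "recursive_fun a \<Longrightarrow> recursive_fun b \<Longrightarrow> recursive_fun (\<lambda>x. pair (a x) (b x))"
  unfolding recursive_fun_iff by (rule rec_on_comp2[OF rec_on_pair2])

lemma recursive_fun_left [rec_intros]: "recursive_fun a \<Longrightarrow> recursive_fun (\<lambda>x. left (a x))"
  unfolding recursive_fun_iff by (rule rec_on_comp1[OF rec_on_left1])

lemma recursive_fun_right [rec_intros]: "recursive_fun a \<Longrightarrow> recursive_fun (\<lambda>x. right (a x))"
  unfolding recursive_fun_iff by (rule rec_on_comp1[OF rec_on_right1])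

lemma rec_on_recursive_fun: "recursive_fun f \<Longrightarrow> rec_on n a \<Longrightarrow> rec_on n (\<lambda>xs. f (a xs))"
  unfolding recursive_fun_iff by (rule rec_on_comp1)

lemma recursive_fun_comp2:
  assumes "recursive_fun (\<lambda>z. g (left z) (right z))" "recursive_fun a" "recursive_fun b"
  shows "recursive_fun (\<lambda>x. g (a x) (b x))"
  using recursive_fun_comp[OF assms(1) recursive_fun_pair[OF assms(2,3)]] by simp

lemma recursive_fun_rec_nat [rec_intros]:
  assumes a: "recursive_fun a" and b: "recursive_fun b"
    and g: "recursive_fun (\<lambda>z. g (left z) (left (right z)) (right (right z)))"
  shows "recursive_fun (\<lambda>x. rec_nat (b x) (\<lambda>k r. g k r x) (a x))"
proof -
  have "rec_on 3 (\<lambda>xs. pair (xs ! 0) (pair (xs ! 1) (xs ! 2)))"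
    by (intro rec_on_comp2[OF rec_on_pair2] rec_on_proj; simp)
  from rec_on_recursive_fun[OF g this]
  have "rec_on 3 (\<lambda>xs. g (xs ! 0) (xs ! 1) (xs ! 2))" by simp
  from rec_on_prec2[OF b[unfolded recursive_fun_iff] this]
  have "rec_on 2 (\<lambda>xs. rec_nat (b (xs ! 1)) (\<lambda>k r. g k r (xs ! 1)) (xs ! 0))" .
  from rec_on_comp2[OF this a[unfolded recursive_fun_iff] rec_on_proj[of 0 1]]
  show ?thesis unfolding recursive_fun_iff by simp
qed

lemma recursive_fun_least:
  assumes f: "recursive_fun (\<lambda>z. f (left z) (right z))" and ex: "\<And>x. \<exists>y. f y x = 0"
  shows "recursive_fun (\<lambda>x. LEAST y. f y x = 0)"
proof -
  have "rec_on 2 (\<lambda>xs. f (xs ! 0) (xs ! 1))"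
    using rec_on_recursive_fun[OF f rec_on_pair2] by simp
  from rec_on_least[OF this ex] show ?thesis unfolding recursive_fun_iff .
qed

lemma recursive_fun_add [rec_intros]:
  "recursive_fun a \<Longrightarrow> recursive_fun b \<Longrightarrow> recursive_fun (\<lambda>x. a x + b x)"
  unfolding recursive_fun_iff by (rule rec_on_add)

lemma recursive_fun_diff [rec_intros]:
  "recursive_fun a \<Longrightarrow> recursive_fun b \<Longrightarrow> recursive_fun (\<lambda>x. a x - b x)"
  unfolding recursive_fun_iff by (rule rec_on_diff)

lemma recursive_fun_mult [rec_intros]:
  assumes "recursive_fun a" "recursive_fun b"
  shows "recursive_fun (\<lambda>x. a x * b x)"
proof -
  have "recursive_fun (\<lambda>x. rec_nat 0 (\<lambda>k r. r + b x) (a x))"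
    by (intro rec_intros recursive_fun_comp[OF assms(2)] assms)
  moreover have "rec_nat 0 (\<lambda>k r. r + m) n = n * m" for m n :: nat
    by (induction n) auto
  ultimately show ?thesis by simp
qed

lemma recursive_fun_power [rec_intros]:
  assumes "recursive_fun a" "recursive_fun b"
  shows "recursive_fun (\<lambda>x. a x ^ b x)"
proof -
  have "recursive_fun (\<lambda>x. rec_nat 1 (\<lambda>k r. r * a x) (b x))"
    by (intro rec_intros recursive_fun_comp[OF assms(1)] assms)
  moreover have "rec_nat 1 (\<lambda>k r. r * m) n = m ^ n" for m n :: nat
    by (induction n) auto
  ultimately show ?thesis by simp
qed

lemma recursive_fun_funpow [rec_intros]:
  assumes "recursive_fun f" "recursive_fun a" "recursive_fun b"
  shows "recursive_fun (\<lambda>x. (f ^^ a x) (b x))"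
proof -
  have "recursive_fun (\<lambda>x. rec_nat (b x) (\<lambda>k r. f r) (a x))"
    by (intro rec_intros recursive_fun_comp[OF assms(1)] assms)
  moreover have "rec_nat z (\<lambda>k r. f r) n = (f ^^ n) z" for n z
    by (induction n) auto
  ultimately show ?thesis by simp
qed

section \<open>Decidable and semidecidable predicates\<close>

definition decidable :: "(nat \<Rightarrow> bool) \<Rightarrow> bool" where
  "decidable P \<longleftrightarrow> recursive_fun (\<lambda>x. if P x then 1 else 0)"

lemma decidable_comp: "decidable P \<Longrightarrow> recursive_fun g \<Longrightarrow> decidable (\<lambda>x. P (g x))"
  unfolding decidable_def by (rule recursive_fun_comp)

lemma decidable_comp2:
  assumes "decidable (\<lambda>z. P (left z) (right z))" "recursive_fun a" "recursive_fun b"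
  shows "decidable (\<lambda>x. P (a x) (b x))"
  using assms unfolding decidable_def by (rule recursive_fun_comp2)

lemma decidable_le [rec_intros]:
  assumes "recursive_fun a" "recursive_fun b"
  shows "decidable (\<lambda>x. a x \<le> b x)"
proof -
  have "recursive_fun (\<lambda>x. 1 - (a x - b x))" by (intro rec_intros assms)
  then show ?thesis unfolding decidable_def by (rule back_subst[of recursive_fun]) auto
qed

lemma decidable_not [rec_intros]:
  assumes "decidable P" shows "decidable (\<lambda>x. \<not> P x)"
proof -
  have "recursive_fun (\<lambda>x. 1 - (if P x then 1 else 0))"
    by (intro rec_intros assms[unfolded decidable_def])
  then show ?thesis unfolding decidable_def by (rule back_subst[of recursive_fun]) auto
qed

lemma decidable_conj [rec_intros]:
  assumes "decidable P" "decidable Q" shows "decidable (\<lambda>x. P x \<and> Q x)"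
proof -
  have "recursive_fun (\<lambda>x. (if P x then 1 else 0) * (if Q x then 1 else 0))"
    by (intro rec_intros assms[unfolded decidable_def])
  then show ?thesis unfolding decidable_def by (rule back_subst[of recursive_fun]) auto
qed

lemma decidable_disj [rec_intros]:
  assumes "decidable P" "decidable Q" shows "decidable (\<lambda>x. P x \<or> Q x)"
proof -
  have "decidable (\<lambda>x. \<not> (\<not> P x \<and> \<not> Q x))" by (intro rec_intros assms)
  then show ?thesis by simp
qed

lemma decidable_eq [rec_intros]:
  assumes "recursive_fun a" "recursive_fun b"
  shows "decidable (\<lambda>x. a x = b x)"
proof -
  have "decidable (\<lambda>x. a x \<le> b x \<and> b x \<le> a x)" by (intro rec_intros assms)
  then show ?thesis by (rule back_subst[of decidable]) auto
qed

lemma decidable_less [rec_intros]: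
  assumes "recursive_fun a" "recursive_fun b"
  shows "decidable (\<lambda>x. a x < b x)"
proof -
  have "decidable (\<lambda>x. Suc (a x) \<le> b x)" by (intro rec_intros assms)
  then show ?thesis by (simp add: Suc_le_eq)
qed

lemma recursive_fun_if [rec_intros]:
  assumes "decidable P" "recursive_fun a" "recursive_fun b"
  shows "recursive_fun (\<lambda>x. if P x then a x else b x)"
proof -
  have "recursive_fun (\<lambda>x. (if P x then 1 else 0) * a x + (1 - (if P x then 1 else 0)) * b x)"
    by (intro rec_intros assms(2,3) assms(1)[unfolded decidable_def])
  then show ?thesis by (rule back_subst[of recursive_fun]) auto
qed

lemma recursive_fun_Least [rec_intros]:
  assumes "decidable (\<lambda>z. P (left z) (right z))" and ex: "\<And>x. \<exists>y. P y x"
  shows "recursive_fun (\<lambda>x. LEAST y. P y x)"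
proof -
  have iff: "(if P y x then 0 else 1) = (0::nat) \<longleftrightarrow> P y x" for x y by simp
  have "recursive_fun (\<lambda>z. if P (left z) (right z) then 0 else 1)"
    by (intro rec_intros assms)
  from recursive_fun_least[OF this, unfolded iff, OF ex] show ?thesis .
qed

text \<open>
  Bounded search is unbounded search that also stops at the bound; the search succeeded exactly if it
  stopped earlier.
\<close>

lemma decidable_bex [rec_intros]:
  assumes "decidable (\<lambda>z. P (left z) (right z))" "recursive_fun a"
  shows "decidable (\<lambda>x. \<exists>y<a x. P y x)"
proof -
  have ex: "\<exists>y. P y x \<or> a x \<le> y" for x
    by (rule exI[of _ "a x"]) simp
  have *: "recursive_fun (\<lambda>x. LEAST y. P y x \<or> a x \<le> y)"
    by (intro rec_intros assms recursive_fun_comp[OF assms(2)] ex)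
  have "decidable (\<lambda>x. (LEAST y. P y x \<or> a x \<le> y) < a x)"
    by (intro decidable_less * assms)
  moreover have "(LEAST y. P y x \<or> a x \<le> y) < a x \<longleftrightarrow> (\<exists>y<a x. P y x)" for x
  proof
    assume l: "(LEAST y. P y x \<or> a x \<le> y) < a x"
    have "P (LEAST y. P y x \<or> a x \<le> y) x \<or> a x \<le> (LEAST y. P y x \<or> a x \<le> y)"
      by (rule LeastI[of _ "a x"]) simp
    with l show "\<exists>y<a x. P y x" by (intro exI[of _ "LEAST y. P y x \<or> a x \<le> y"]) auto
  next
    assume "\<exists>y<a x. P y x"
    then obtain y where "y < a x" "P y x" by blast
    with Least_le[of "\<lambda>y. P y x \<or> a x \<le> y" y]
    show "(LEAST y. P y x \<or> a x \<le> y) < a x" by simp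
  qed
  ultimately show ?thesis by simp
qed

lemma decidable_ball [rec_intros]:
  assumes "decidable (\<lambda>z. P (left z) (right z))" "recursive_fun a"
  shows "decidable (\<lambda>x. \<forall>y<a x. P y x)"
proof -
  have "decidable (\<lambda>x. \<not> (\<exists>y<a x. \<not> P y x))" by (intro rec_intros assms)
  then show ?thesis by simp
qed

lemma recursive_set_iff: "recursive_set A \<longleftrightarrow> decidable (\<lambda>x. x \<in> A)"
  by (simp add: recursive_set_def decidable_def)

text \<open>
  In contrast to \<open>Sigma01\<close> the witness is the first component, which is the packing that the rules
  for quantifiers produce.
\<close>

definition semidecidable :: "(nat \<Rightarrow> bool) \<Rightarrow> bool" where
  "semidecidable P \<longleftrightarrow> (\<exists>Q. decidable (\<lambda>z. Q (left z) (right z)) \<and> (\<forall>x. P x \<longleftrightarrow> (\<exists>y. Q y x)))"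

lemma decidable_semidecidable: "decidable P \<Longrightarrow> semidecidable P"
  unfolding semidecidable_def
  by (rule exI[of _ "\<lambda>_. P"]) (auto intro!: decidable_comp[of P] rec_intros)

lemma semidecidable_ex:
  assumes "semidecidable (\<lambda>z. P (left z) (right z))"
  shows "semidecidable (\<lambda>x. \<exists>y. P y x)"
proof -
  obtain Q where Q: "decidable (\<lambda>z. Q (left z) (right z))"
    "\<And>z. P (left z) (right z) \<longleftrightarrow> (\<exists>y. Q y z)"
    using assms unfolding semidecidable_def by blast
  have "decidable (\<lambda>z. Q (left (left z)) (pair (right (left z)) (right z)))"
    by (intro decidable_comp2[OF Q(1)] rec_intros)
  moreover have "(\<exists>y. P y x) \<longleftrightarrow> (\<exists>w. Q (left w) (pair (right w) x))" for x
    using Q(2) by (metis left_pair right_pair)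
  ultimately show ?thesis unfolding semidecidable_def
    by (intro exI[of _ "\<lambda>w x. Q (left w) (pair (right w) x)"]) blast
qed

lemma semidecidable_conj:
  assumes "semidecidable P" "semidecidable Q" shows "semidecidable (\<lambda>x. P x \<and> Q x)"
proof -
  obtain P' Q' where P': "decidable (\<lambda>z. P' (left z) (right z))" "\<And>x. P x \<longleftrightarrow> (\<exists>y. P' y x)"
    and Q': "decidable (\<lambda>z. Q' (left z) (right z))" "\<And>x. Q x \<longleftrightarrow> (\<exists>y. Q' y x)"
    using assms unfolding semidecidable_def by blast
  have "semidecidable (\<lambda>x. \<exists>y z. P' y x \<and> Q' z x)"
    by (intro semidecidable_ex decidable_semidecidable decidable_conj
      decidable_comp2[OF P'(1)] decidable_comp2[OF Q'(1)] rec_intros)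
  then show ?thesis by (simp add: P'(2) Q'(2))
qed

lemma Sigma01I:
  assumes "semidecidable (\<lambda>x. x \<in> A)" shows "Sigma01 A"
proof -
  obtain Q where Q: "decidable (\<lambda>z. Q (left z) (right z))" "\<And>x. x \<in> A \<longleftrightarrow> (\<exists>y. Q y x)"
    using assms unfolding semidecidable_def by blast
  have "recursive_fun (\<lambda>z. if Q (right z) (left z) then 0 else 1)"
    by (intro rec_intros decidable_comp2[OF Q(1)])
  from rec_on_recursive_fun[OF this rec_on_pair2]
  have "rec_on 2 (\<lambda>xs. if Q (xs ! 1) (xs ! 0) then 0 else 1)" by simp
  then obtain F where F: "general_recursive 2 F"
    "\<And>xs. length xs = 2 \<Longrightarrow> (if Q (xs ! 1) (xs ! 0) then 0 else 1) = F xs"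
    unfolding rec_on_def by blast
  have "F [x, y] = 0 \<longleftrightarrow> Q y x" for x y
    using F(2)[of "[x, y]"] by (auto split: if_splits)
  with F(1) Q(2) show ?thesis unfolding Sigma01_def by blast
qed

section \<open>Access to coded lists\<close>

text \<open>
  The code \<open>0\<close> of the empty list is a fixed point of the coded tail function, so that a list can be
  dropped any number of times, and its length is the first time at which nothing is left.
\<close>

definition code_drop :: "nat \<Rightarrow> nat \<Rightarrow> nat" where
  "code_drop i l = ((\<lambda>l. right (l - 1)) ^^ i) l"

definition code_nth :: "nat \<Rightarrow> nat \<Rightarrow> nat" where
  "code_nth l i = left (code_drop i l - 1)"

definition code_length :: "nat \<Rightarrow> nat" where
  "code_length l = (LEAST i. code_drop i l = 0)"

lemma code_drop [simp]: "code_drop i (list_encode xs) = list_encode (drop i xs)"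
proof (induction i)
  case (Suc i)
  have "right (list_encode ys - 1) = list_encode (tl ys)" for ys by (cases ys) auto
  with Suc show ?case by (simp add: code_drop_def drop_Suc tl_drop)
qed (simp add: code_drop_def)

lemma code_nth [simp]: "i < length xs \<Longrightarrow> code_nth (list_encode xs) i = xs ! i"
  by (simp add: code_nth_def Cons_nth_drop_Suc[symmetric])

lemma list_encode_eq_0 [simp]: "list_encode xs = 0 \<longleftrightarrow> xs = []"
  by (cases xs) auto

lemma code_length [simp]: "code_length (list_encode xs) = length xs"
  unfolding code_length_def by (rule Least_equality) auto

lemma recursive_fun_code_drop [rec_intros]:
  "recursive_fun a \<Longrightarrow> recursive_fun b \<Longrightarrow> recursive_fun (\<lambda>x. code_drop (a x) (b x))"
  unfolding code_drop_def by (intro rec_intros)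

lemma recursive_fun_code_nth [rec_intros]:
  "recursive_fun a \<Longrightarrow> recursive_fun b \<Longrightarrow> recursive_fun (\<lambda>x. code_nth (a x) (b x))"
  unfolding code_nth_def by (intro rec_intros)

lemma recursive_fun_code_length [rec_intros]:
  assumes "recursive_fun a" shows "recursive_fun (\<lambda>x. code_length (a x))"
proof -
  have ex: "\<exists>y. code_drop y x = 0" for x
    by (rule exI[of _ "length (list_decode x)"])
       (metis code_drop drop_all list_encode.simps(1) list_decode_inverse order_refl)
  have "recursive_fun code_length" unfolding code_length_def
    by (intro rec_intros ex)
  from recursive_fun_comp[OF this assms] show ?thesis .
qed

section \<open>A universal machine\<close>

text \<open>
  The machine has a control stack of instructions and one number as its data. The data are used as a
  stack made of nested pairs, with the current argument list or result on top. Besides sequencing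
  and a loop, the instruction set consists of a few rearrangements of this stack, each tailored to
  one step in the evaluation of a composition, a primitive recursion or a minimisation.
\<close>

abbreviation code_cons :: "nat \<Rightarrow> nat \<Rightarrow> nat" where "code_cons x l \<equiv> Suc (pair x l)"

fun select :: "(nat \<Rightarrow> nat) list \<Rightarrow> nat \<Rightarrow> nat \<Rightarrow> nat" where
  "select [] i v = v"
| "select (f # fs) i v = (if i = 0 then f v else select fs (i - 1) v)"

lemma recursive_fun_select:
  assumes "\<forall>f \<in> set fs. recursive_fun f" "recursive_fun a" "recursive_fun b"
  shows "recursive_fun (\<lambda>x. select fs (a x) (b x))"
  using assms
proof (induction fs arbitrary: a)
  case (Cons f fs)
  then have "recursive_fun (\<lambda>x. f (b x))" "recursive_fun (\<lambda>x. select fs (a x - 1) (b x))"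
    by (auto intro!: recursive_fun_comp[of f] Cons.IH rec_intros)
  then show ?case unfolding select.simps by (intro rec_intros Cons.prems)
qed simp

lemma select_surj: "f \<in> set fs \<Longrightarrow> \<exists>i. \<forall>v. select fs i v = f v"
proof (induction fs)
  case (Cons g fs)
  show ?case
  proof (cases "f = g")
    case True
    then show ?thesis by (intro exI[of _ 0]) simp
  next
    case False
    with Cons obtain i where "\<forall>v. select fs i v = f v" by auto
    then show ?thesis by (intro exI[of _ "Suc i"]) simp
  qed
qed simp

definition zero_op :: "nat \<Rightarrow> nat" where
  "zero_op v = pair 0 (right v)"
definition succ_op :: "nat \<Rightarrow> nat" where
  "succ_op v = pair (Suc (left (left v - 1))) (right v)"
definition tl_op :: "nat \<Rightarrow> nat" where
  "tl_op v = pair (right (left v - 1)) (right v)"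
definition hd_op :: "nat \<Rightarrow> nat" where
  "hd_op v = pair (left (left v - 1)) (right v)"

definition nil_op :: "nat \<Rightarrow> nat" where
  "nil_op v = pair (left v) (pair 0 (right v))"
definition dup_op :: "nat \<Rightarrow> nat" where
  "dup_op v = pair (left v) v"
definition cons_op :: "nat \<Rightarrow> nat" where
  "cons_op v = (let w = right v; u = right w in
     pair (left w) (pair (code_cons (left v) (left u)) (right u)))"

text \<open>
  In the loop of a primitive recursion the stack holds the number of rounds to go, the number of
  rounds done, the accumulated value and the parameters. A call pushes the arguments of the step
  function on top of this frame and the return puts its result back in place.
\<close>

definition prec_init_op :: "nat \<Rightarrow> nat" where
  "prec_init_op v = (let l = left v - 1 in
     pair (right l) (pair (left l) (pair (right l) (right v))))"
definition prec_start_op :: "nat \<Rightarrow> nat" where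
  "prec_start_op v = (let w = right v in pair (left w) (pair 0 (pair (left v) (right w))))"
definition prec_call_op :: "nat \<Rightarrow> nat" where
  "prec_call_op v = (let w = right v; u = right w; s = right u in
     pair (code_cons (left w) (code_cons (left u) (left s)))
       (pair (left v - 1) (pair (Suc (left w)) s)))"
definition prec_return_op :: "nat \<Rightarrow> nat" where
  "prec_return_op v = (let w = right v; u = right w in
     pair (left w) (pair (left u) (pair (left v) (right u))))"
definition prec_exit_op :: "nat \<Rightarrow> nat" where
  "prec_exit_op v = (let u = right (right v) in pair (left u) (right (right u)))"

text \<open>
  In the loop of a minimisation the stack holds the last value, the next candidate and the
  parameters. The first value is the dummy \<open>1\<close>, which lets the loop start; the candidate is advanced
  before it is tested, so the exit subtracts one.
\<close>

definition search_init_op :: "nat \<Rightarrow> nat" where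
  "search_init_op v = pair 1 (pair 0 v)"
definition search_call_op :: "nat \<Rightarrow> nat" where
  "search_call_op v = (let w = right v; u = right w in
     pair (code_cons (left w) (left u)) (pair (Suc (left w)) u))"
definition search_exit_op :: "nat \<Rightarrow> nat" where
  "search_exit_op v = (let w = right v in pair (left w - 1) (right (right w)))"

lemmas op_defs = zero_op_def succ_op_def tl_op_def hd_op_def nil_op_def dup_op_def cons_op_def
  prec_init_op_def prec_start_op_def prec_call_op_def prec_return_op_def prec_exit_op_def
  search_init_op_def search_call_op_def search_exit_op_def

text \<open>
  The projection \<open>right\<close> serves as the instruction that removes the top of the data stack.
\<close>

definition ops :: "(nat \<Rightarrow> nat) list" where
  "ops = [zero_op, succ_op, tl_op, hd_op, right, nil_op, dup_op, cons_op, prec_init_op,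
     prec_start_op, prec_call_op, prec_return_op, prec_exit_op, search_init_op, search_call_op,
     search_exit_op]"

lemma recursive_ops: "\<forall>f \<in> set ops. recursive_fun f"
proof -
  have "recursive_fun zero_op" "recursive_fun succ_op" "recursive_fun tl_op" "recursive_fun hd_op"
    "recursive_fun (\<lambda>v. right v)" "recursive_fun nil_op" "recursive_fun dup_op" "recursive_fun cons_op"
    "recursive_fun prec_init_op" "recursive_fun prec_start_op" "recursive_fun prec_call_op"
    "recursive_fun prec_return_op" "recursive_fun prec_exit_op" "recursive_fun search_init_op"
    "recursive_fun search_call_op" "recursive_fun search_exit_op"
    unfolding op_defs[abs_def] Let_def by (intro rec_intros)+
  then show ?thesis by (simp add: ops_def)
qed

text \<open>
  Tags \<open>0\<close> and \<open>1\<close> mark the two control structures, higher tags the elements of \<open>ops\<close>.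
\<close>

definition seq :: "nat \<Rightarrow> nat \<Rightarrow> nat" where "seq p q = pair 0 (pair p q)"
definition loop :: "nat \<Rightarrow> nat" where "loop p = pair 1 p"
definition op_code :: "nat \<Rightarrow> nat" where "op_code i = pair (Suc (Suc i)) 0"

text \<open>
  A state pairs the code of the list of pending programs with the data; it is final when that list is
  empty, and then the step function leaves it unchanged.
\<close>

definition step :: "nat \<Rightarrow> nat" where
  "step st = (let K = left st; v = right st; p = left (K - 1); rest = right (K - 1); arg = right p in
     if K = 0 then st
     else if left p = 0 then pair (code_cons (left arg) (code_cons (right arg) rest)) v
     else if left p = 1 then
       (if left v = 0 then pair rest v else pair (code_cons arg K) v)
     else pair rest (select ops (left p - 2) v))"

lemma recursive_fun_step: "recursive_fun step"
  unfolding step_def[abs_def] Let_def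
  by (intro rec_intros recursive_fun_select recursive_ops)

lemma step_halted [simp]: "step (pair 0 v) = pair 0 v"
  by (simp add: step_def)

lemma step_seq [simp]:
  "step (pair (code_cons (seq p q) K) v) = pair (code_cons p (code_cons q K)) v"
  by (simp add: step_def seq_def)

lemma step_loop [simp]:
  "step (pair (code_cons (loop p) K) v) =
     (if left v = 0 then pair K v else pair (code_cons p (code_cons (loop p) K)) v)"
  by (simp add: step_def loop_def)

lemma step_op [simp]:
  "step (pair (code_cons (op_code i) K) v) = pair K (select ops i v)"
  by (simp add: step_def op_code_def)

text \<open>
  The quantification over the rest \<open>K\<close> of the control stack makes this notion compositional.
\<close>

definition runs :: "nat \<Rightarrow> nat \<Rightarrow> nat \<Rightarrow> bool" where
  "runs p v w \<longleftrightarrow> (\<forall>K. \<exists>s. (step ^^ s) (pair (code_cons p K) v) = pair K w)"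

lemma funpow_trans: "(f ^^ m) x = y \<Longrightarrow> (f ^^ n) y = z \<Longrightarrow> (f ^^ (n + m)) x = z"
  by (simp add: funpow_add)

lemma runs_op:
  assumes "f \<in> set ops" shows "\<exists>p. \<forall>v. runs p v (f v)"
proof -
  obtain i where i: "\<forall>v. select ops i v = f v" using select_surj[OF assms] by blast
  have "runs (op_code i) v (f v)" for v
    unfolding runs_def by (intro allI exI[of _ 1]) (simp add: i)
  then show ?thesis by blast
qed

lemma runs_seq:
  assumes "runs p u v" "runs q v w" shows "runs (seq p q) u w"
  unfolding runs_def
proof
  fix K
  obtain s where s: "(step ^^ s) (pair (code_cons p (code_cons q K)) u) = pair (code_cons q K) v"
    using assms(1) unfolding runs_def by blast
  obtain t where t: "(step ^^ t) (pair (code_cons q K) v) = pair K w"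
    using assms(2) unfolding runs_def by blast
  have "(step ^^ 1) (pair (code_cons (seq p q) K) u) = pair (code_cons p (code_cons q K)) u" by simp
  from funpow_trans[OF funpow_trans[OF this s] t]
  show "\<exists>s. (step ^^ s) (pair (code_cons (seq p q) K) u) = pair K w" by blast
qed

lemma runs_loop_exit: "left v = 0 \<Longrightarrow> runs (loop p) v v"
  unfolding runs_def by (intro allI exI[of _ 1]) simp

lemma runs_loop_again:
  assumes "left u \<noteq> 0" "runs p u v" "runs (loop p) v w" shows "runs (loop p) u w"
  unfolding runs_def
proof
  fix K
  obtain s where s: "(step ^^ s) (pair (code_cons p (code_cons (loop p) K)) u) = pair (code_cons (loop p) K) v"
    using assms(2) unfolding runs_def by blast
  obtain t where t: "(step ^^ t) (pair (code_cons (loop p) K) v) = pair K w"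
    using assms(3) unfolding runs_def by blast
  have "(step ^^ 1) (pair (code_cons (loop p) K) u) = pair (code_cons p (code_cons (loop p) K)) u"
    using assms(1) by simp
  from funpow_trans[OF funpow_trans[OF this s] t]
  show "\<exists>s. (step ^^ s) (pair (code_cons (loop p) K) u) = pair K w" by blast
qed

text \<open>
  The rest \<open>r\<close> of the data stack is left intact, so that a program may keep its own data there while
  it runs a subprogram.
\<close>

definition computes :: "nat \<Rightarrow> nat \<Rightarrow> (nat list \<Rightarrow> nat) \<Rightarrow> bool" where
  "computes p n F \<longleftrightarrow>
     (\<forall>xs r. length xs = n \<longrightarrow> runs p (pair (list_encode xs) r) (pair (F xs) r))"

lemma computesD: "computes p n F \<Longrightarrow> length xs = n \<Longrightarrow>
    runs p (pair (list_encode xs) r) (pair (F xs) r)"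
  by (simp add: computes_def)

lemma op_program:
  assumes "f \<in> set ops" shows "\<exists>p. \<forall>v w. f v = w \<longrightarrow> runs p v w"
  using runs_op[OF assms] by metis

lemma ops_members:
  "zero_op \<in> set ops" "succ_op \<in> set ops" "tl_op \<in> set ops" "hd_op \<in> set ops"
  "right \<in> set ops" "nil_op \<in> set ops" "dup_op \<in> set ops" "cons_op \<in> set ops"
  "prec_init_op \<in> set ops" "prec_start_op \<in> set ops" "prec_call_op \<in> set ops" "prec_return_op \<in> set ops"
  "prec_exit_op \<in> set ops" "search_init_op \<in> set ops" "search_call_op \<in> set ops" "search_exit_op \<in> set ops"
  by (simp_all add: ops_def)

lemma computes_zero: "\<exists>p. computes p n (\<lambda>_. 0)"
proof -
  obtain p where p: "\<And>v w. zero_op v = w \<Longrightarrow> runs p v w"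
    using op_program[of zero_op] ops_members by blast
  have "computes p n (\<lambda>_. 0)"
    unfolding computes_def by (intro allI impI p) (simp add: zero_op_def)
  then show ?thesis by blast
qed

lemma computes_succ: "\<exists>p. computes p 1 (\<lambda>xs. Suc (xs ! 0))"
proof -
  obtain p where p: "\<And>v w. succ_op v = w \<Longrightarrow> runs p v w"
    using op_program[of succ_op] ops_members by blast
  have "computes p 1 (\<lambda>xs. Suc (xs ! 0))"
    unfolding computes_def by (intro allI impI p) (auto simp: succ_op_def length_Suc_conv)
  then show ?thesis by blast
qed

lemma computes_proj: "i < n \<Longrightarrow> \<exists>p. computes p n (\<lambda>xs. xs ! i)"
proof (induction i arbitrary: n)
  case 0
  obtain p where p: "\<And>v w. hd_op v = w \<Longrightarrow> runs p v w"
    using op_program[of hd_op] ops_members by blast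
  have "computes p n (\<lambda>xs. xs ! 0)"
    unfolding computes_def
    by (intro allI impI p) (use 0 in \<open>auto simp: hd_op_def gr0_conv_Suc length_Suc_conv\<close>)
  then show ?case by blast
next
  case (Suc i)
  then obtain m where m: "n = Suc m" "i < m" by (cases n) auto
  obtain p where p: "computes p m (\<lambda>xs. xs ! i)" using Suc.IH[OF m(2)] by blast
  obtain q where q: "\<And>v w. tl_op v = w \<Longrightarrow> runs q v w"
    using op_program[of tl_op] ops_members by blast
  have "computes (seq q p) n (\<lambda>xs. xs ! Suc i)"
    unfolding computes_def
  proof (intro allI impI)
    fix xs :: "nat list" and r assume "length xs = n"
    then obtain x ys where xs: "xs = x # ys" "length ys = m" by (auto simp: m length_Suc_conv)
    have "runs q (pair (list_encode xs) r) (pair (list_encode ys) r)"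
      by (rule q) (simp add: xs tl_op_def)
    from runs_seq[OF this computesD[OF p xs(2)]]
    show "runs (seq q p) (pair (list_encode xs) r) (pair (xs ! Suc i) r)" by (simp add: xs)
  qed
  then show ?case by blast
qed

text \<open>
  The argument list is duplicated before each inner function is run; as results are consed onto an
  accumulator, the inner functions are evaluated from right to left.
\<close>

lemma argument_list_program:
  assumes "\<forall>g \<in> set gs. \<exists>p. computes p n g"
  shows "\<exists>p. \<forall>(xs :: nat list) acc r. length xs = n \<longrightarrow>
    runs p (pair (list_encode xs) (pair (list_encode acc) r))
      (pair (list_encode xs) (pair (list_encode (map (\<lambda>g. g xs) gs @ acc)) r))"
  using assms
proof (induction gs)
  case Nil
  obtain p where p: "\<And>v w. dup_op v = w \<Longrightarrow> runs p v w"
    using op_program[of dup_op] ops_members by blast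
  obtain q where q: "\<And>v w. right v = w \<Longrightarrow> runs q v w"
    using op_program[of right] ops_members by blast
  have "runs (seq p q) v v" for v
    by (rule runs_seq[OF p q]) (rule refl, simp add: dup_op_def)
  then show ?case by auto
next
  case (Cons g gs)
  obtain d where d: "\<And>v w. dup_op v = w \<Longrightarrow> runs d v w"
    using op_program[of dup_op] ops_members by blast
  obtain c where c: "\<And>v w. cons_op v = w \<Longrightarrow> runs c v w"
    using op_program[of cons_op] ops_members by blast
  obtain p where p: "\<And>xs acc r. length xs = n \<Longrightarrow>
    runs p (pair (list_encode xs) (pair (list_encode acc) r))
      (pair (list_encode xs) (pair (list_encode (map (\<lambda>g. g xs) gs @ acc)) r))"
    using Cons by auto
  obtain q where q: "computes q n g" using Cons.prems by auto
  have "runs (seq p (seq d (seq q c))) (pair (list_encode xs) (pair (list_encode acc) r))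
      (pair (list_encode xs) (pair (list_encode (map (\<lambda>g. g xs) (g # gs) @ acc)) r))"
    if "length xs = n" for xs acc r
  proof -
    have d': "runs d (pair (list_encode xs) v) (pair (list_encode xs) (pair (list_encode xs) v))" for v
      by (rule d) (simp add: dup_op_def)
    have c': "runs c (pair y (pair (list_encode xs) (pair (list_encode ys) r)))
      (pair (list_encode xs) (pair (list_encode (y # ys)) r))" for y ys
      by (rule c) (simp add: cons_op_def Let_def)
    show ?thesis
      using runs_seq[OF p[OF that] runs_seq[OF d' runs_seq[OF computesD[OF q that] c']]] by simp
  qed
  then show ?case by blast
qed

lemma computes_comp:
  assumes "\<exists>p. computes p (length gs) f" "\<forall>g \<in> set gs. \<exists>p. computes p n g"
  shows "\<exists>p. computes p n (\<lambda>xs. f (map (\<lambda>g. g xs) gs))"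
proof -
  obtain p where p: "computes p (length gs) f" using assms(1) by blast
  obtain q where q: "\<And>xs acc r. length xs = n \<Longrightarrow>
    runs q (pair (list_encode xs) (pair (list_encode acc) r))
      (pair (list_encode xs) (pair (list_encode (map (\<lambda>g. g xs) gs @ acc)) r))"
    using argument_list_program[OF assms(2)] by blast
  obtain a where a: "\<And>v w. nil_op v = w \<Longrightarrow> runs a v w"
    using op_program[of nil_op] ops_members by blast
  obtain b where b: "\<And>v w. right v = w \<Longrightarrow> runs b v w"
    using op_program[of right] ops_members by blast
  have "runs (seq a (seq q (seq b p))) (pair (list_encode xs) r) (pair (f (map (\<lambda>g. g xs) gs)) r)"
    if "length xs = n" for xs r
  proof (rule runs_seq[OF a runs_seq[OF q[OF that, of "[]"] runs_seq[OF b computesD[OF p]]]])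
    show "nil_op (pair (list_encode xs) r) = pair (list_encode xs) (pair (list_encode []) r)"
      by (simp add: nil_op_def)
  qed simp_all
  then show ?thesis unfolding computes_def by blast
qed

lemma computes_prec:
  assumes "computes f n F" "computes g (n + 2) G"
  shows "\<exists>p. computes p (n + 1) (\<lambda>xs. rec_nat (F (tl xs)) (\<lambda>k r. G (k # r # tl xs)) (hd xs))"
proof -
  obtain i where i: "\<And>v w. prec_init_op v = w \<Longrightarrow> runs i v w"
    using op_program[of prec_init_op] ops_members by blast
  obtain s where s: "\<And>v w. prec_start_op v = w \<Longrightarrow> runs s v w"
    using op_program[of prec_start_op] ops_members by blast
  obtain c where c: "\<And>v w. prec_call_op v = w \<Longrightarrow> runs c v w"
    using op_program[of prec_call_op] ops_members by blast
  obtain t where t: "\<And>v w. prec_return_op v = w \<Longrightarrow> runs t v w"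
    using op_program[of prec_return_op] ops_members by blast
  obtain e where e: "\<And>v w. prec_exit_op v = w \<Longrightarrow> runs e v w"
    using op_program[of prec_exit_op] ops_members by blast
  define body where "body = seq c (seq g t)"
  have "runs (seq i (seq f (seq s (seq (loop body) e)))) (pair (list_encode xs) r)
     (pair (rec_nat (F (tl xs)) (\<lambda>k r. G (k # r # tl xs)) (hd xs)) r)"
    if len: "length xs = n + 1" for xs r
  proof -
    obtain m ys where xs: "xs = m # ys" "length ys = n" using len by (auto simp: length_Suc_conv)
    define H where "H = rec_nat (F ys) (\<lambda>k r. G (k # r # ys))"
    define state where "state = (\<lambda>j k. pair j (pair k (pair (H k) (pair (list_encode ys) r))))"
    have body: "runs body (state (Suc j) k) (state j (Suc k))" for j k
      unfolding body_def
    proof (rule runs_seq[OF c runs_seq[OF computesD[OF assms(2)] t]])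
      show "prec_call_op (state (Suc j) k) = pair (list_encode (k # H k # ys))
          (pair j (pair (Suc k) (pair (list_encode ys) r)))"
        by (simp add: prec_call_op_def state_def)
    qed (simp_all add: prec_return_op_def state_def H_def xs)
    have loop: "runs (loop body) (state j k) (state 0 (k + j))" for j k
    proof (induction j arbitrary: k)
      case 0
      show ?case by (simp add: runs_loop_exit state_def)
    next
      case (Suc j)
      show ?case
        by (rule runs_loop_again[OF _ body]) (use Suc[of "Suc k"] in \<open>simp_all add: state_def\<close>)
    qed
    show ?thesis
    proof (rule runs_seq[OF i runs_seq[OF computesD[OF assms(1) xs(2)]
            runs_seq[OF s runs_seq[OF loop e]]]])
      show "prec_init_op (pair (list_encode xs) r) =
          pair (list_encode ys) (pair m (pair (list_encode ys) r))"
        by (simp add: xs prec_init_op_def)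
      show "prec_start_op (pair (F ys) (pair m (pair (list_encode ys) r))) = state m 0"
        by (simp add: prec_start_op_def state_def H_def)
      show "prec_exit_op (state 0 (0 + m)) =
          pair (rec_nat (F (tl xs)) (\<lambda>k r. G (k # r # tl xs)) (hd xs)) r"
        by (simp add: prec_exit_op_def state_def H_def xs)
    qed
  qed
  then show ?thesis unfolding computes_def by blast
qed

lemma computes_minim:
  assumes "computes f (n + 1) F" and total: "\<forall>xs. length xs = n \<longrightarrow> (\<exists>y. F (y # xs) = 0)"
  shows "\<exists>p. computes p n (\<lambda>xs. LEAST y. F (y # xs) = 0)"
proof -
  obtain i where i: "\<And>v w. search_init_op v = w \<Longrightarrow> runs i v w"
    using op_program[of search_init_op] ops_members by blast
  obtain c where c: "\<And>v w. search_call_op v = w \<Longrightarrow> runs c v w"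
    using op_program[of search_call_op] ops_members by blast
  obtain e where e: "\<And>v w. search_exit_op v = w \<Longrightarrow> runs e v w"
    using op_program[of search_exit_op] ops_members by blast
  define body where "body = seq c f"
  have "runs (seq i (seq (loop body) e)) (pair (list_encode xs) r)
     (pair (LEAST y. F (y # xs) = 0) r)"
    if len: "length xs = n" for xs r
  proof -
    define y where "y = (LEAST y. F (y # xs) = 0)"
    have y: "F (y # xs) = 0" unfolding y_def by (rule LeastI_ex) (use total len in blast)
    have below: "F (k # xs) \<noteq> 0" if "k < y" for k
      using not_less_Least that unfolding y_def by blast
    define state where "state = (\<lambda>b k. pair b (pair k (pair (list_encode xs) r)))"
    have body: "runs body (state b k) (state (F (k # xs)) (Suc k))" for b k
      unfolding body_def state_def
    proof (rule runs_seq[OF c computesD[OF assms(1)]])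
      show "search_call_op (pair b (pair k (pair (list_encode xs) r))) =
          pair (list_encode (k # xs)) (pair (Suc k) (pair (list_encode xs) r))"
        by (simp add: search_call_op_def)
    qed (simp add: len)
    \<comment> \<open>Induction on the distance \<open>j\<close> to the least zero \<open>y\<close>; the last value is still nonzero.\<close>
    have loop: "runs (loop body) (state (Suc b) (y - j)) (state 0 (Suc y))" if "j \<le> y" for b j
      using that
    proof (induction j arbitrary: b)
      case 0
      have "runs (loop body) (state 0 (Suc y)) (state 0 (Suc y))"
        by (rule runs_loop_exit) (simp add: state_def)
      with body[of "Suc b" y] show ?case
        by (intro runs_loop_again[of "state (Suc b) (y - 0)" body]) (auto simp: y state_def)
    next
      case (Suc j)
      have k: "Suc (y - Suc j) = y - j" "y - Suc j < y" using Suc.prems by auto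
      obtain b' where b': "F ((y - Suc j) # xs) = Suc b'"
        using below[OF k(2)] not0_implies_Suc by blast
      from body[of "Suc b" "y - Suc j"]
      have "runs body (state (Suc b) (y - Suc j)) (state (Suc b') (y - j))"
        unfolding k(1) b' .
      from runs_loop_again[OF _ this Suc.IH] Suc.prems show ?case by (simp add: state_def)
    qed
    have "runs (loop body) (state 1 0) (state 0 (Suc y))" using loop[of y 0] by simp
    from runs_seq[OF i runs_seq[OF this e]]
    show ?thesis unfolding y_def[symmetric]
      by (simp add: search_init_op_def search_exit_op_def state_def)
  qed
  then show ?thesis unfolding computes_def by blast
qed

text \<open>
  The induction on the derivation only ever needs programs for total functions, because minimisation
  is restricted to regular functions.
\<close>

theorem every_recursive_function_has_program:
  "general_recursive n F \<Longrightarrow> \<exists>p. computes p n F"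
proof (induction rule: general_recursive.induct)
  case (comp gs f n)
  then show ?case by (intro computes_comp) auto
qed (use computes_zero computes_succ computes_proj computes_prec computes_minim in blast)+

text \<open>
  Here \<open>n\<close> codes a program with its input and \<open>w\<close> codes a second argument with a number of steps. The
  final state with result \<open>0\<close> and empty stacks is the number \<open>0\<close>.
\<close>

definition accepts :: "nat \<Rightarrow> nat \<Rightarrow> bool" where
  "accepts n w \<longleftrightarrow> (step ^^ right w)
     (pair (code_cons (left n) 0) (pair (code_cons (right n) (code_cons (left w) 0)) 0)) = 0"

lemma decidable_accepts: "decidable (\<lambda>z. accepts (left z) (right z))"
  unfolding accepts_def by (intro rec_intros recursive_fun_step)

text \<open>
  A run is deterministic and final states are fixed points, so whenever the machine is seen halted,
  it shows the value of the function.
\<close>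

lemma Sigma01_accepts:
  assumes "Sigma01 B" obtains e where "\<And>x. x \<in> B \<longleftrightarrow> (\<exists>w. accepts (pair e x) w)"
proof -
  obtain F where F: "general_recursive 2 F" "\<And>x. x \<in> B \<longleftrightarrow> (\<exists>y. F [x, y] = 0)"
    using assms unfolding Sigma01_def by blast
  obtain e where e: "computes e 2 F" using every_recursive_function_has_program[OF F(1)] by blast
  have "F [x, y] = 0 \<longleftrightarrow> (\<exists>s. accepts (pair e x) (pair y s))" for x y
  proof -
    let ?start = "pair (code_cons e 0) (pair (list_encode [x, y]) 0)"
    obtain t where t: "(step ^^ t) ?start = pair 0 (pair (F [x, y]) 0)"
      using computesD[OF e, of "[x, y]" 0] unfolding runs_def by auto
    have halted: "(step ^^ k) (pair 0 v) = pair 0 v" for k v by (induction k) auto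
    have "F [x, y] = 0" if "(step ^^ s) ?start = pair 0 (pair 0 0)" for s
    proof -
      have "(step ^^ (t + s)) ?start = pair 0 (pair 0 0)"
        by (rule funpow_trans[OF that halted])
      moreover have "(step ^^ (s + t)) ?start = pair 0 (pair (F [x, y]) 0)"
        by (rule funpow_trans[OF t halted])
      ultimately show ?thesis by (metis add.commute left_pair right_pair)
    qed
    then show ?thesis using t unfolding accepts_def by (auto simp: pair_0_0)
  qed
  with F(2) have "x \<in> B \<longleftrightarrow> (\<exists>w. accepts (pair e x) w)" for x
    by (metis pair_left_right)
  with that show thesis by blast
qed

section \<open>Subshifts and their languages\<close>

text \<open>
  The windows \<open>{-n..n}\<close> are cofinal among the finite sets of coordinates, so they give a neighbourhood
  base in the product topology.
\<close>

lemma closedin_full_shift_iff: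
  "closedin (full_shift S) Y \<longleftrightarrow>
     (\<forall>y \<in> Y. \<forall>i. y i \<in> S) \<and>
     (\<forall>y. (\<forall>n. \<exists>z \<in> Y. \<forall>i. \<bar>i\<bar> \<le> int n \<longrightarrow> z i = y i) \<longrightarrow> y \<in> Y)" (is "_ \<longleftrightarrow> ?vals \<and> ?limits")
proof -
  have space: "topspace (full_shift S) = {y. \<forall>i. y i \<in> S}"
    by (auto simp: full_shift_def PiE_def Pi_def extensional_def)
  show ?thesis
  proof (intro iffI conjI)
    assume closed: "closedin (full_shift S) Y"
    show vals: ?vals
      using closedin_subset[OF closed] by (auto simp: space)
    show ?limits
    proof (intro allI impI, rule ccontr)
      fix y assume near: "\<forall>n. \<exists>z \<in> Y. \<forall>i. \<bar>i\<bar> \<le> int n \<longrightarrow> z i = y i" and "y \<notin> Y"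
      have "y i \<in> S" for i
      proof -
        from near obtain z where "z \<in> Y" and "\<forall>j. \<bar>j\<bar> \<le> int (nat \<bar>i\<bar>) \<longrightarrow> z j = y j" by blast
        then have "z i = y i" by auto
        with \<open>z \<in> Y\<close> vals show ?thesis by metis
      qed
      with \<open>y \<notin> Y\<close> have mem: "y \<in> topspace (full_shift S) - Y" by (simp add: space)
      have opn: "openin (full_shift S) (topspace (full_shift S) - Y)"
        using closed by (simp add: closedin_def)
      obtain U where "finite {i \<in> UNIV. U i \<noteq> topspace (discrete_topology S)}"
        and U: "y \<in> Pi\<^sub>E UNIV U" "Pi\<^sub>E UNIV U \<subseteq> topspace (full_shift S) - Y"
        using bspec[OF opn[unfolded full_shift_def openin_product_topology_alt] mem[unfolded full_shift_def]]
        unfolding full_shift_def[symmetric] by blast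
      then have fin: "finite {i. U i \<noteq> S}" by simp
      \<comment> \<open>A window large enough to contain all restricted coordinates.\<close>
      obtain n where n: "\<forall>i. U i \<noteq> S \<longrightarrow> \<bar>i\<bar> \<le> int n"
      proof -
        obtain b where "\<And>i. i \<in> (\<lambda>i. nat \<bar>i\<bar>) ` {i. U i \<noteq> S} \<Longrightarrow> i \<le> b"
          using finite_nat_set_iff_bounded_le fin by (metis finite_imageI)
        then have "nat \<bar>i\<bar> \<le> b" if "U i \<noteq> S" for i using that by blast
        then show thesis by (intro that[of b]) (simp add: nat_le_iff)
      qed
      obtain z where z: "z \<in> Y" "\<forall>i. \<bar>i\<bar> \<le> int n \<longrightarrow> z i = y i" using near by blast
      have "z i \<in> U i" for i
        using n z vals U(1) by (cases "U i = S") (auto simp: PiE_def Pi_def)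
      then have "z \<in> Pi\<^sub>E UNIV U" by auto
      with U(2) z(1) show False by blast
    qed
  next
    assume A: "?vals \<and> ?limits"
    have "openin (full_shift S) (topspace (full_shift S) - Y)"
      unfolding full_shift_def openin_product_topology_alt
    proof
      fix y assume "y \<in> topspace (product_topology (\<lambda>_. discrete_topology S) UNIV) - Y"
      then have y: "\<forall>i. y i \<in> S" "y \<notin> Y" using space by (auto simp: full_shift_def)
      then obtain n where n: "\<forall>z \<in> Y. \<exists>i. \<bar>i\<bar> \<le> int n \<and> z i \<noteq> y i" using A by blast
      define U where "U = (\<lambda>i. if \<bar>i\<bar> \<le> int n then {y i} else S)"
      have "{i \<in> UNIV. U i \<noteq> topspace (discrete_topology S)} \<subseteq> {- int n..int n}"
        by (auto simp: U_def)
      then have "finite {i \<in> UNIV. U i \<noteq> topspace (discrete_topology S)}"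
        by (rule finite_subset) simp
      moreover have "\<forall>i \<in> UNIV. openin (discrete_topology S) (U i)" "y \<in> Pi\<^sub>E UNIV U"
        using y by (auto simp: U_def)
      moreover have "Pi\<^sub>E UNIV U \<subseteq> topspace (product_topology (\<lambda>_. discrete_topology S) UNIV) - Y"
      proof
        fix z assume z: "z \<in> Pi\<^sub>E UNIV U"
        have "U i \<subseteq> S" for i using y by (auto simp: U_def)
        with z have "\<forall>i. z i \<in> S" by (auto simp: PiE_def Pi_def)
        moreover have "z i = y i" if "\<bar>i\<bar> \<le> int n" for i
        proof -
          have "z i \<in> U i" using z by (auto simp: PiE_def Pi_def)
          then show ?thesis using that by (simp add: U_def)
        qed
        then have "z \<notin> Y" using n by blast
        ultimately show "z \<in> topspace (product_topology (\<lambda>_. discrete_topology S) UNIV) - Y"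
          using space by (auto simp: full_shift_def)
      qed
      ultimately show "\<exists>U. finite {i \<in> UNIV. U i \<noteq> topspace (discrete_topology S)} \<and>
          (\<forall>i \<in> UNIV. openin (discrete_topology S) (U i)) \<and> y \<in> Pi\<^sub>E UNIV U \<and>
          Pi\<^sub>E UNIV U \<subseteq> topspace (product_topology (\<lambda>_. discrete_topology S) UNIV) - Y"
        by blast
    qed
    moreover have "Y \<subseteq> topspace (full_shift S)" using A by (auto simp: space)
    ultimately show "closedin (full_shift S) Y" by (simp add: closedin_def)
  qed
qed

lemma subshift_shift_mem:
  assumes "subshift S Y" "y \<in> Y" shows "(\<lambda>i. y (i + c)) \<in> Y"
proof (induction c rule: int_induct[where k = 0])
  case base
  show ?case using assms by simp
next
  case (step1 c)
  have "shift_map (\<lambda>i. y (i + c)) \<in> Y"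
    using assms(1) step1(2) unfolding subshift_def by blast
  then show ?case by (simp add: shift_map_def algebra_simps)
next
  case (step2 c)
  have "(\<lambda>i. y (i + c)) \<in> shift_map ` Y"
    using assms(1) step2(2) by (simp add: subshift_def)
  then obtain z where z: "z \<in> Y" "shift_map z = (\<lambda>i. y (i + c))" by (metis imageE)
  have "z i = y (i + (c - 1))" for i
    using fun_cong[OF z(2), of "i - 1"] by (simp add: shift_map_def algebra_simps)
  then have "z = (\<lambda>i. y (i + (c - 1)))" by (rule ext)
  with z(1) show ?case by simp
qed

lemma subshiftI:
  assumes "\<And>y i. y \<in> Y \<Longrightarrow> y i \<in> S"
    and limits: "\<And>y. (\<And>n. \<exists>z \<in> Y. \<forall>i. \<bar>i\<bar> \<le> int n \<longrightarrow> z i = y i) \<Longrightarrow> y \<in> Y"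
    and shifts: "\<And>y c. y \<in> Y \<Longrightarrow> (\<lambda>i. y (i + c)) \<in> Y"
  shows "subshift S Y"
  unfolding subshift_def closedin_full_shift_iff
proof (intro conjI)
  show "shift_map ` Y = Y"
  proof
    show "shift_map ` Y \<subseteq> Y" using shifts by (auto simp: shift_map_def)
    show "Y \<subseteq> shift_map ` Y"
    proof
      fix y assume "y \<in> Y"
      then have "(\<lambda>i. y (i + (-1))) \<in> Y" by (rule shifts)
      moreover have "y = shift_map (\<lambda>i. y (i + (-1)))" by (simp add: shift_map_def)
      ultimately show "y \<in> shift_map ` Y" by blast
    qed
  qed
qed (use assms in blast)+

text \<open>
  Shift invariance allows the windows of \<open>y\<close> to be found at any place of a point of \<open>Y\<close>: shifting
  that point moves the window back, and \<open>y\<close> becomes a limit of points of \<open>Y\<close>.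
\<close>

lemma subshift_mem_if_windows:
  assumes "subshift S Y" and windows: "\<And>p n. \<exists>z \<in> Y. \<exists>q. \<forall>k<n. y (p + int k) = z (q + int k)"
  shows "y \<in> Y"
proof -
  have "\<exists>z \<in> Y. \<forall>i. \<bar>i\<bar> \<le> int n \<longrightarrow> z i = y i" for n
  proof -
    obtain z q where z: "z \<in> Y" "\<forall>k < 2 * n + 1. y (- int n + int k) = z (q + int k)"
      using windows by blast
    have "z (i + (q + int n)) = y i" if "\<bar>i\<bar> \<le> int n" for i
    proof -
      have k: "nat (i + int n) < 2 * n + 1" "int (nat (i + int n)) = i + int n" using that by linarith+
      have "y (- int n + int (nat (i + int n))) = z (q + int (nat (i + int n)))"
        using z(2) k(1) by blast
      then show ?thesis unfolding k(2) by (simp add: algebra_simps)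
    qed
    then show ?thesis
      by (intro bexI[OF _ subshift_shift_mem[OF assms(1) z(1), of "q + int n"]]) simp
  qed
  moreover have "\<forall>y. (\<forall>n. \<exists>z \<in> Y. \<forall>i. \<bar>i\<bar> \<le> int n \<longrightarrow> z i = y i) \<longrightarrow> y \<in> Y"
    using assms(1) by (simp add: subshift_def closedin_full_shift_iff)
  ultimately show ?thesis by blast
qed

lemma occurs_at_window: "occurs_at (map (\<lambda>k. y (p + int k)) [0..<n]) y p"
  by (simp add: occurs_at_def)

lemma subshift_subset_if_language_subset:
  assumes "subshift S Z" "language Y \<subseteq> language Z" shows "Y \<subseteq> Z"
proof
  fix y assume y: "y \<in> Y"
  show "y \<in> Z"
  proof (rule subshift_mem_if_windows[OF assms(1)])
    fix p n
    have "map (\<lambda>k. y (p + int k)) [0..<n] \<in> language Z"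
      using assms(2) y occurs_at_window[of y p n] unfolding language_def by blast
    then show "\<exists>z \<in> Z. \<exists>q. \<forall>k<n. y (p + int k) = z (q + int k)"
      by (auto simp: language_def occurs_at_def) metis
  qed
qed

text \<open>
  A subshift is determined by its language, so the definite description denotes any subshift with
  the right language.
\<close>

lemma lang_inv_eq:
  assumes "subshift S Y" "language Y = {u. \<exists>w \<in> L. sublist u w}"
  shows "lang_inv S L = Y"
  unfolding lang_inv_def
proof (rule the_equality)
  fix Z assume "subshift S Z \<and> language Z = {u. \<exists>w \<in> L. sublist u w}"
  then show "Z = Y" using assms
    by (intro antisym subshift_subset_if_language_subset[of S]) auto
qed (use assms in simp)

lemma language_sublist:
  assumes "w \<in> language Y" "sublist u w" shows "u \<in> language Y"
proof -
  obtain y p where y: "y \<in> Y" "occurs_at w y p" using assms(1) by (auto simp: language_def)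
  obtain l r where w: "w = l @ u @ r" using assms(2) by (auto simp: sublist_def)
  have "occurs_at u y (p + int (length l))"
    unfolding occurs_at_def
  proof (intro allI impI)
    fix k assume "k < length u"
    then show "y (p + int (length l) + int k) = u ! k"
      using y(2)[unfolded occurs_at_def, rule_format, of "length l + k"]
      by (simp add: w nth_append add.assoc)
  qed
  with y(1) show ?thesis by (auto simp: language_def)
qed

section \<open>Points with at most one 1\<close>

definition zero_point :: "int \<Rightarrow> nat" where "zero_point = (\<lambda>_. 0)"

definition at_most_one :: "(int \<Rightarrow> nat) set" where
  "at_most_one = {y. (\<forall>i. y i \<in> {0, 1}) \<and> (\<forall>i j. y i = 1 \<longrightarrow> y j = 1 \<longrightarrow> i = j)}"

lemma at_most_one_eq_0: "y \<in> at_most_one \<Longrightarrow> y k \<noteq> 1 \<Longrightarrow> y k = 0"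
  unfolding at_most_one_def by blast

lemma at_most_one_eq:
  assumes "y \<in> at_most_one" "y c = 1" shows "y k = (if k = c then 1 else 0)"
proof -
  have "k = c" if "y k = 1" using assms that unfolding at_most_one_def by blast
  then show ?thesis using assms(2) at_most_one_eq_0[OF assms(1), of k] by metis
qed

lemma at_most_one_cases:
  assumes "y \<in> at_most_one"
  obtains "y = zero_point" | c where "y = (\<lambda>k. if k = c then 1 else 0)"
proof (cases "\<exists>c. y c = 1")
  case True
  then obtain c where "y c = 1" by blast
  then have "y = (\<lambda>k. if k = c then 1 else 0)"
    using at_most_one_eq[OF assms] by (intro ext)
  then show thesis by (rule that(2))
next
  case False
  then have "y k = 0" for k using at_most_one_eq_0[OF assms] by blast
  then have "y = zero_point" unfolding zero_point_def by (rule ext)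
  then show thesis by (rule that(1))
qed

lemma zero_point_at_most_one: "zero_point \<in> at_most_one"
  by (simp add: at_most_one_def zero_point_def)

lemma single_one_at_most_one: "(\<lambda>k. if k = c then 1 else 0) \<in> at_most_one"
  by (auto simp: at_most_one_def)

lemma countable_at_most_one: "countable at_most_one"
proof (rule countable_subset)
  show "at_most_one \<subseteq> insert zero_point (range (\<lambda>c k. if k = c then 1 else 0))"
    using at_most_one_cases by blast
qed simp

lemma subshift_zero_point: "subshift {0, 1} {zero_point}"
proof (rule subshiftI)
  fix y :: "int \<Rightarrow> nat"
  assume near: "\<And>n. \<exists>z \<in> {zero_point}. \<forall>i. \<bar>i\<bar> \<le> int n \<longrightarrow> z i = y i"
  have "y i = 0" for i using near[of "nat \<bar>i\<bar>"] by (simp add: zero_point_def)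
  then show "y \<in> {zero_point}" by (auto simp: zero_point_def)
qed (auto simp: zero_point_def)

lemma subshift_at_most_one: "subshift {0, 1} at_most_one"
proof (rule subshiftI)
  fix y :: "int \<Rightarrow> nat"
  assume near: "\<And>n. \<exists>z \<in> at_most_one. \<forall>i. \<bar>i\<bar> \<le> int n \<longrightarrow> z i = y i"
  have agree: "\<exists>z \<in> at_most_one. z i = y i \<and> z j = y j" for i j
  proof -
    obtain z where "z \<in> at_most_one" and z: "\<forall>k. \<bar>k\<bar> \<le> int (nat \<bar>i\<bar> + nat \<bar>j\<bar>) \<longrightarrow> z k = y k"
      using near by blast
    moreover have "z i = y i" "z j = y j" using z[rule_format, of i] z[rule_format, of j] by simp_all
    ultimately show ?thesis by blast
  qed
  have "y i \<in> {0, 1}" for i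
    using agree[of i i] unfolding at_most_one_def by (metis (mono_tags, lifting) mem_Collect_eq)
  moreover have "i = j" if "y i = 1" "y j = 1" for i j
    using agree[of i j] that unfolding at_most_one_def by (metis (mono_tags, lifting) mem_Collect_eq)
  ultimately show "y \<in> at_most_one" by (simp add: at_most_one_def)
next
  fix y :: "int \<Rightarrow> nat" and c assume "y \<in> at_most_one"
  then have y: "\<And>i. y i \<in> {0, 1}" "\<And>i j. y i = 1 \<Longrightarrow> y j = 1 \<Longrightarrow> i = j"
    unfolding at_most_one_def by blast+
  have "i = j" if "y (i + c) = 1" "y (j + c) = 1" for i j
    using y(2)[OF that] by simp
  with y(1) show "(\<lambda>i. y (i + c)) \<in> at_most_one" unfolding at_most_one_def by blast
qed (simp add: at_most_one_def)

lemma language_zero_point: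
  "language {zero_point} = {u. \<exists>w \<in> {replicate a 0 | a. True}. sublist u w}"
proof (intro set_eqI iffI)
  fix u assume "u \<in> language {zero_point}"
  then have "u = replicate (length u) 0"
    by (auto simp: language_def occurs_at_def zero_point_def intro!: nth_equalityI)
  then show "u \<in> {u. \<exists>w \<in> {replicate a 0 | a. True}. sublist u w}"
    using sublist_order.order_refl by blast
next
  fix u assume "u \<in> {u. \<exists>w \<in> {replicate a (0::nat) | a. True}. sublist u w}"
  then obtain a where "sublist u (replicate a 0)" by blast
  moreover have "replicate a 0 \<in> language {zero_point}"
    by (simp add: language_def occurs_at_def zero_point_def)
  ultimately show "u \<in> language {zero_point}" using language_sublist by blast
qed

lemma language_at_most_one:
  "language at_most_one = {u. \<exists>w \<in> {replicate a 0 @ [1] @ replicate b 0 | a b. True}. sublist u w}"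
    (is "_ = ?R")
proof (intro set_eqI iffI)
  fix u assume "u \<in> language at_most_one"
  then obtain y p where y: "y \<in> at_most_one" "\<forall>k < length u. y (p + int k) = u ! k"
    by (auto simp: language_def occurs_at_def)
  have one: "k = l" if "k < length u" "l < length u" "u ! k = 1" "u ! l = 1" for k l
  proof -
    have "y (p + int k) = 1" "y (p + int l) = 1" using y(2) that by auto
    then have "p + int k = p + int l" using y(1) unfolding at_most_one_def by blast
    then show ?thesis by simp
  qed
  have bin: "u ! k = 0 \<or> u ! k = 1" if "k < length u" for k
    using at_most_one_eq_0[OF y(1), of "p + int k"] y(2) that by metis
  show "u \<in> ?R"
  proof (cases "\<exists>k < length u. u ! k = 1")
    case True
    then obtain k where k: "k < length u" "u ! k = 1" by blast
    have "u = replicate k 0 @ [1] @ replicate (length u - Suc k) 0"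
    proof (rule nth_equalityI)
      fix i assume i: "i < length u"
      then show "u ! i = (replicate k 0 @ [1] @ replicate (length u - Suc k) 0) ! i"
        using bin[OF i] one[OF i k(1)] k by (cases "i = k") (auto simp: nth_append)
    qed (use k in simp)
    then show ?thesis using sublist_order.order_refl by blast
  next
    case False
    then have "u = replicate (length u) 0" using bin by (auto intro!: nth_equalityI)
    then have "sublist u (replicate (length u) 0 @ [1] @ replicate 0 0)"
      by (metis sublist_appendI append_Nil)
    then show ?thesis by blast
  qed
next
  fix u assume "u \<in> ?R"
  then obtain a b where "sublist u (replicate a 0 @ [1] @ replicate b 0)" by blast
  moreover have "occurs_at (replicate a 0 @ [1] @ replicate b 0) (\<lambda>k. if k = int a then 1 else 0) 0"
    by (auto simp: occurs_at_def nth_append nth_Cons')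
  then have "replicate a 0 @ [1] @ replicate b 0 \<in> language at_most_one"
    using single_one_at_most_one unfolding language_def by blast
  ultimately show "u \<in> language at_most_one" using language_sublist by blast
qed

section \<open>Orbit closures of points with growing gaps\<close>

text \<open>
  The subtractions are those of natural numbers, but the assumptions force all gaps to be positive
  and hence \<open>a\<close> to be strictly increasing.
\<close>

locale growing_gaps =
  fixes a :: "nat \<Rightarrow> nat"
  assumes first_gap: "a 0 < a 1"
    and gaps_grow: "a (Suc t) - a t < a (Suc (Suc t)) - a (Suc t)"
begin

definition base :: "int \<Rightarrow> nat" where
  "base i = (if \<exists>t. i = int (a t) then 1 else 0)"

text \<open>
  The closure of the shift orbit of \<open>base\<close>, described by its windows.
\<close>

definition orbit_closure :: "(int \<Rightarrow> nat) set" where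
  "orbit_closure = {y. \<forall>p n. \<exists>q. \<forall>k<n. y (p + int k) = base (q + int k)}"

lemma gap_strict_mono: "strict_mono (\<lambda>t. a (Suc t) - a t)"
  by (simp add: strict_mono_Suc_iff gaps_grow)

lemma gap_large: "t < a (Suc t) - a t"
proof (induction t)
  case 0
  show ?case using first_gap by simp
next
  case (Suc t)
  then show ?case using gaps_grow[of t] by linarith
qed

lemma strict_mono_a: "strict_mono a"
proof -
  have "a t < a (Suc t)" for t using gap_large[of t] by linarith
  then show ?thesis by (simp add: strict_mono_Suc_iff)
qed

lemma ones_far_apart:
  assumes "s < t" shows "a s + t \<le> a t"
proof -
  obtain r where r: "t = Suc r" "s \<le> r" using assms by (cases t) auto
  have "a s \<le> a r" using r(2) strict_mono_a by (simp add: strict_mono_less_eq)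
  with gap_large[of r] show ?thesis unfolding r(1) by linarith
qed

lemma base_eq_1: "base i = 1 \<longleftrightarrow> (\<exists>t. i = int (a t))" by (simp add: base_def)

lemma base_01: "base i = 0 \<or> base i = 1" by (simp add: base_def)

lemma base_between: "int (a t) < i \<Longrightarrow> i < int (a (Suc t)) \<Longrightarrow> base i = 0"
  using strict_mono_a unfolding base_def
  by (metis not_less_eq of_nat_less_iff strict_mono_less)

lemma base_adjacent_ones:
  assumes "base u = 1" "base v = 1" "u < v" and zeros: "\<And>i. u < i \<Longrightarrow> i < v \<Longrightarrow> base i = 0"
  obtains t where "u = int (a t)" "v = int (a (Suc t))"
proof -
  obtain s t where st: "u = int (a s)" "v = int (a t)" using assms(1,2) base_eq_1 by auto
  then have "s < t" using assms(3) strict_mono_a by (simp add: strict_mono_less)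
  have "t = Suc s"
  proof (rule ccontr)
    assume "t \<noteq> Suc s"
    with \<open>s < t\<close> have "Suc s < t" by simp
    then have "a s < a (Suc s)" "a (Suc s) < a t" using strict_mono_a by (simp_all add: strict_mono_less)
    then have "base (int (a (Suc s))) = 0" using zeros st by simp
    then show False by (auto simp: base_def split: if_splits)
  qed
  with st that show thesis by blast
qed

lemma orbit_closure_01: "y \<in> orbit_closure \<Longrightarrow> y i \<in> {0, 1}"
proof -
  assume "y \<in> orbit_closure"
  then obtain q where "\<forall>k<1. y (i + int k) = base (q + int k)" unfolding orbit_closure_def by blast
  then show ?thesis using base_01 by auto
qed

text \<open>
  Every window of \<open>y\<close> around the two 1s occurs in \<open>base\<close>, at two consecutive marks whose gap is
  \<open>j - i\<close>. No other pair of consecutive marks has this gap, so all windows occur at the same place.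
\<close>

lemma orbit_closure_adjacent_ones:
  assumes y: "y \<in> orbit_closure" and ones: "y i = 1" "y j = 1" "i < j"
    and zeros: "\<And>k. i < k \<Longrightarrow> k < j \<Longrightarrow> y k = 0"
  obtains t where "j - i = int (a (Suc t) - a t)" "\<And>k. y k = base (k - i + int (a t))"
proof -
  have window: "\<exists>t. j - i = int (a (Suc t) - a t) \<and> (\<forall>k. l \<le> k \<longrightarrow> k \<le> h \<longrightarrow> y k = base (k - i + int (a t)))"
    if lh: "l \<le> i" "j \<le> h" for l h
  proof -
    obtain q where q: "\<forall>k < nat (h - l + 1). y (l + int k) = base (q + int k)"
      using y unfolding orbit_closure_def by blast
    have eq: "y k = base (k + (q - l))" if "l \<le> k" "k \<le> h" for k
      using q[rule_format, of "nat (k - l)"] that by (simp add: algebra_simps)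
    obtain t where t: "i + (q - l) = int (a t)" "j + (q - l) = int (a (Suc t))"
    proof (rule base_adjacent_ones)
      show "base (i + (q - l)) = 1" "base (j + (q - l)) = 1" "i + (q - l) < j + (q - l)"
        using eq[of i] eq[of j] ones lh by linarith+
      show "base k = 0" if "i + (q - l) < k" "k < j + (q - l)" for k
        using eq[of "k - (q - l)"] zeros[of "k - (q - l)"] that \<open>l \<le> i\<close> \<open>j \<le> h\<close> by simp
    qed
    have "a t < a (Suc t)" using strict_mono_a by (simp add: strict_mono_less)
    then have "j - i = int (a (Suc t) - a t)" using t by linarith
    moreover have "k + (q - l) = k - i + int (a t)" for k using t(1) by linarith
    ultimately show ?thesis using eq by metis
  qed
  obtain t where t: "j - i = int (a (Suc t) - a t)" using window[of i j] by blast
  have "y k = base (k - i + int (a t))" for k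
  proof -
    obtain t' where t': "j - i = int (a (Suc t') - a t')"
      "\<forall>m. min i k \<le> m \<longrightarrow> m \<le> max j k \<longrightarrow> y m = base (m - i + int (a t'))"
      using window[of "min i k" "max j k"] by auto
    then have "t' = t" using t gap_strict_mono by (metis of_nat_eq_iff strict_mono_eq)
    with t'(2) show ?thesis by simp
  qed
  with t that show thesis by blast
qed

lemma orbit_closure_cases:
  assumes "y \<in> orbit_closure"
  obtains "y \<in> at_most_one" | c where "y = (\<lambda>k. base (k + c))"
proof (cases "y \<in> at_most_one")
  case False
  have "\<exists>i j. i < j \<and> y i = 1 \<and> y j = 1"
  proof -
    obtain i j where "y i = 1" "y j = 1" "i \<noteq> j"
      using False orbit_closure_01[OF assms] unfolding at_most_one_def by blast
    then show ?thesis by (cases i j rule: linorder_cases) blast+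
  qed
  then obtain i j where ij: "i < j" "y i = 1" "y j = 1" by blast
  \<comment> \<open>Going right from the 1 at \<open>i\<close>, the first further 1 gives two adjacent 1s.\<close>
  define d where "d = (LEAST d. 0 < d \<and> y (i + int d) = 1)"
  have d: "0 < d \<and> y (i + int d) = 1"
    unfolding d_def by (rule LeastI[of _ "nat (j - i)"]) (use ij in simp)
  have zeros: "y k = 0" if "i < k" "k < i + int d" for k
  proof -
    have "\<not> (0 < nat (k - i) \<and> y (i + int (nat (k - i))) = 1)"
      using not_less_Least[of "nat (k - i)" "\<lambda>d. 0 < d \<and> y (i + int d) = 1"] that
      unfolding d_def[symmetric] by simp
    then show ?thesis using that orbit_closure_01[OF assms, of k] by simp
  qed
  have "y (i + int d) = 1" "i < i + int d" using d by simp_all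
  from orbit_closure_adjacent_ones[OF assms ij(2) this zeros]
  obtain t where "\<And>k. y k = base (k - i + int (a t))" by blast
  then have "y = (\<lambda>k. base (k + (int (a t) - i)))" by (auto simp: algebra_simps)
  then show thesis by (rule that(2))
qed (rule that(1))

text \<open>
  Around the mark \<open>a n\<close> there is no other 1 at distance less than \<open>n\<close>, so a window of length \<open>n\<close> can
  be placed there with its only 1 at any prescribed position.
\<close>

lemma base_around_one:
  assumes "m < n" "k < n"
  shows "base (int (a n) - int m + int k) = (if k = m then 1 else 0)"
proof (cases "k = m")
  case True
  then show ?thesis by (auto simp: base_def)
next
  case False
  have "int (a n) - int m + int k \<noteq> int (a s)" for s
  proof
    assume s: "int (a n) - int m + int k = int (a s)"
    consider "s < n" | "s = n" | "n < s" by linarith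
    then show False
    proof cases
      case 1
      from ones_far_apart[OF 1] s assms show False by linarith
    next
      case 2
      with s False show False by simp
    next
      case 3
      from ones_far_apart[OF 3] s assms 3 show False by linarith
    qed
  qed
  with False show ?thesis by (simp add: base_def)
qed

lemma base_negative: "i < 0 \<Longrightarrow> base i = 0" by (auto simp: base_def)

lemma base_in_orbit_closure: "base \<in> orbit_closure" unfolding orbit_closure_def by blast

lemma base_not_at_most_one: "base \<notin> at_most_one"
proof
  assume "base \<in> at_most_one"
  moreover have "base (int (a 0)) = 1" "base (int (a 1)) = 1" by (auto simp: base_def)
  ultimately have "int (a 0) = int (a 1)" unfolding at_most_one_def by blast
  with first_gap show False by simp
qed

lemma at_most_one_subset_orbit_closure: "at_most_one \<subseteq> orbit_closure"
proof
  fix y assume y: "y \<in> at_most_one"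
  have "\<exists>q. \<forall>k<n. y (p + int k) = base (q + int k)" for p n
  proof (cases "\<exists>m<n. y (p + int m) = 1")
    case True
    then obtain m where m: "m < n" "y (p + int m) = 1" by blast
    have "y (p + int k) = (if k = m then 1 else 0)" for k
      using at_most_one_eq[OF y m(2), of "p + int k"] by simp
    then have "\<forall>k<n. y (p + int k) = base (int (a n) - int m + int k)"
      using base_around_one[OF m(1)] by simp
    then show ?thesis by blast
  next
    case False
    then have "y (p + int k) = 0" if "k < n" for k
      using at_most_one_eq_0[OF y] that by blast
    then have "\<forall>k<n. y (p + int k) = base (- int n + int k)" using base_negative by simp
    then show ?thesis by blast
  qed
  then show "y \<in> orbit_closure" unfolding orbit_closure_def by blast
qed

lemma subshift_orbit_closure: "subshift {0, 1} orbit_closure"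
proof (rule subshiftI)
  fix y :: "int \<Rightarrow> nat"
  assume near: "\<And>n. \<exists>z \<in> orbit_closure. \<forall>i. \<bar>i\<bar> \<le> int n \<longrightarrow> z i = y i"
  have "\<exists>q. \<forall>k<n. y (p + int k) = base (q + int k)" for p n
  proof -
    obtain z where z: "z \<in> orbit_closure" "\<forall>i. \<bar>i\<bar> \<le> int (nat \<bar>p\<bar> + n) \<longrightarrow> z i = y i" using near by blast
    obtain q where "\<forall>k<n. z (p + int k) = base (q + int k)" using z(1) unfolding orbit_closure_def by blast
    moreover have "z (p + int k) = y (p + int k)" if "k < n" for k using z(2) that by auto
    ultimately show ?thesis by auto
  qed
  then show "y \<in> orbit_closure" unfolding orbit_closure_def by blast
next
  fix y :: "int \<Rightarrow> nat" and c assume y: "y \<in> orbit_closure"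
  have "\<exists>q. \<forall>k<n. y (p + int k + c) = base (q + int k)" for p n
  proof -
    obtain q where "\<forall>k<n. y ((p + c) + int k) = base (q + int k)" using y unfolding orbit_closure_def by blast
    then show ?thesis by (metis add.assoc add.commute)
  qed
  then show "(\<lambda>i. y (i + c)) \<in> orbit_closure" unfolding orbit_closure_def by blast
qed (rule orbit_closure_01)

lemma countable_orbit_closure: "countable orbit_closure"
proof (rule countable_subset)
  show "orbit_closure \<subseteq> at_most_one \<union> range (\<lambda>c k. base (k + c))" using orbit_closure_cases by blast
qed (simp add: countable_at_most_one)

lemma language_orbit_closure: "language orbit_closure = {w. \<exists>q. occurs_at w base q}"
proof (intro set_eqI iffI)
  fix w assume "w \<in> language orbit_closure"
  then obtain y p where y: "y \<in> orbit_closure" "\<forall>k < length w. y (p + int k) = w ! k"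
    by (auto simp: language_def occurs_at_def)
  obtain q where "\<forall>k < length w. y (p + int k) = base (q + int k)"
    using y(1) unfolding orbit_closure_def by blast
  with y(2) have "occurs_at w base q" by (simp add: occurs_at_def)
  then show "w \<in> {w. \<exists>q. occurs_at w base q}" by blast
qed (use base_in_orbit_closure in \<open>auto simp: language_def\<close>)

lemma weakly_transitive_orbit_closure: "weakly_transitive orbit_closure"
  unfolding weakly_transitive_def language_orbit_closure using base_in_orbit_closure by blast

text \<open>
  A subsystem with a point that has two 1s contains a shift of \<open>base\<close>, hence \<open>base\<close> itself and the
  whole orbit closure. A subsystem with a point that has exactly one 1 contains all shifts of this
  point and, as their limit, the zero point.
\<close>

lemma proper_subsystems_orbit_closure:
  "{Y. subshift {0, 1} Y \<and> Y \<subset> orbit_closure \<and> Y \<noteq> {}} = {at_most_one, {zero_point}}"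
proof (intro set_eqI iffI)
  fix Y assume "Y \<in> {Y. subshift {0, 1} Y \<and> Y \<subset> orbit_closure \<and> Y \<noteq> {}}"
  then have Y: "subshift {0, 1} Y" "Y \<subset> orbit_closure" "Y \<noteq> {}" by auto
  have "(\<lambda>k. base (k + c)) \<notin> Y" for c
  proof
    assume "(\<lambda>k. base (k + c)) \<in> Y"
    from subshift_shift_mem[OF Y(1) this, of "- c"] have "base \<in> Y" by simp
    have "orbit_closure \<subseteq> Y"
    proof
      fix z assume "z \<in> orbit_closure"
      then show "z \<in> Y"
        using \<open>base \<in> Y\<close> unfolding orbit_closure_def
        by (intro subshift_mem_if_windows[OF Y(1)]) blast
    qed
    with Y(2) show False by blast
  qed
  then have sub: "Y \<subseteq> at_most_one" using Y(2) orbit_closure_cases by (metis psubsetD subsetI)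
  show "Y \<in> {at_most_one, {zero_point}}"
  proof (cases "Y \<subseteq> {zero_point}")
    case True
    with Y(3) show ?thesis by blast
  next
    case False
    then obtain c where c: "(\<lambda>k. if k = c then 1 else 0) \<in> Y"
      using sub at_most_one_cases by (metis insertI1 subsetD subsetI)
    have single: "(\<lambda>k. if k = d then 1 else 0) \<in> Y" for d
    proof -
      have "(\<lambda>k. if k + (c - d) = c then 1 else 0) \<in> Y" using subshift_shift_mem[OF Y(1) c] .
      moreover have "(\<lambda>k. if k + (c - d) = c then 1 else 0) = (\<lambda>k. if k = d then 1 else (0::nat))"
        by (auto simp: algebra_simps)
      ultimately show ?thesis by simp
    qed
    have "zero_point \<in> Y"
    proof (rule subshift_mem_if_windows[OF Y(1)])
      show "\<exists>z \<in> Y. \<exists>q. \<forall>k<n. zero_point (p + int k) = z (q + int k)" for p n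
        by (intro bexI[OF _ single[of "-1"]] exI[of _ 0]) (simp add: zero_point_def)
    qed
    with single have "at_most_one \<subseteq> Y" using at_most_one_cases by (metis subsetI)
    with sub show ?thesis by blast
  qed
next
  fix Y assume "Y \<in> {at_most_one, {zero_point}}"
  moreover have proper: "at_most_one \<subset> orbit_closure"
    using at_most_one_subset_orbit_closure base_in_orbit_closure base_not_at_most_one by blast
  moreover have "{zero_point} \<subset> orbit_closure"
    by (rule le_less_trans[OF _ proper]) (simp add: zero_point_at_most_one)
  ultimately show "Y \<in> {Y. subshift {0, 1} Y \<and> Y \<subset> orbit_closure \<and> Y \<noteq> {}}"
    using subshift_at_most_one subshift_zero_point zero_point_at_most_one by auto
qed

text \<open>
  This turns membership in the language into a finite search. A word with two 1s contains two
  marks, the later of which has index at most the length of the word, because marks that close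
  together cannot come late; a word with one 1 is found around the mark \<open>a (length w)\<close>; and a word of
  zeros is found left of the origin. Starting positions are shifted by \<open>length w\<close> to make them natural
  numbers.
\<close>

lemma language_orbit_closure_bounded:
  "w \<in> language orbit_closure \<longleftrightarrow>
     (\<exists>q \<le> a (length w) + length w. occurs_at w base (int q - int (length w)))"
proof
  assume "w \<in> language orbit_closure"
  then obtain p where p: "\<forall>k < length w. base (p + int k) = w ! k"
    by (auto simp: language_orbit_closure occurs_at_def)
  let ?n = "length w"
  consider (none) "\<forall>k<?n. w ! k = 0"
    | (one) m where "m < ?n" "\<forall>k<?n. w ! k = (if k = m then 1 else 0)"
    | (two) l m where "l < m" "m < ?n" "w ! l = 1" "w ! m = 1"
  proof (cases "\<forall>k<?n. w ! k = 0")
    case False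
    then obtain m where m: "m < ?n" "w ! m = 1" using p base_01 by metis
    show thesis
    proof (cases "\<forall>k<?n. w ! k = (if k = m then 1 else 0)")
      case False
      then obtain k where k: "k < ?n" "w ! k \<noteq> (if k = m then 1 else 0)" by blast
      then have "k \<noteq> m" "w ! k = 1" using m p base_01[of "p + int k"] by (auto split: if_splits)
      with k m two[of k m] two[of m k] show thesis by linarith
    qed (use m one in blast)
  qed (use none in blast)
  then obtain q where q: "q \<le> a ?n + ?n" "\<forall>k<?n. base (int q - int ?n + int k) = w ! k"
  proof cases
    case none
    then show thesis using that[of 0] by (simp add: base_negative)
  next
    case one
    have "base (int (a ?n + ?n - m) - int ?n + int k) = w ! k" if "k < ?n" for k
      using base_around_one[OF one(1) that] one that by (simp add: algebra_simps)
    then show thesis using that[of "a ?n + ?n - m"] by simp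
  next
    case two
    then obtain s t where st: "p + int l = int (a s)" "p + int m = int (a t)"
      using p base_eq_1 by (metis order.strict_trans)
    then have "a s < a t" using two(1) by linarith
    then have "s < t" using strict_mono_a by (simp add: strict_mono_less)
    from ones_far_apart[OF this] have "t \<le> ?n" using st two by linarith
    then have "a s \<le> a ?n" using \<open>s < t\<close> strict_mono_a by (simp add: strict_mono_less_eq)
    then have "0 \<le> p + int ?n" "p + int ?n \<le> int (a ?n + ?n)" using st(1) two by linarith+
    then show thesis using that[of "nat (p + int ?n)"] p by simp
  qed
  then show "\<exists>q \<le> a ?n + ?n. occurs_at w base (int q - int ?n)" by (auto simp: occurs_at_def)
qed (auto simp: language_orbit_closure)

text \<open>
  The first gap occurs only once in \<open>base\<close>, so this word fixes the position of the point.
\<close>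

lemma prefix_occurrence:
  assumes y: "y \<in> orbit_closure" and occ: "occurs_at (map (\<lambda>k. base (int k)) [0..<Suc (a 1)]) y p"
  shows "y = (\<lambda>k. base (k - p))"
proof -
  have eq: "y (p + int k) = base (int k)" if "k \<le> a 1" for k
    using occ that unfolding occurs_at_def by (simp del: upt_Suc)
  have ones: "y (p + int (a 0)) = 1" "y (p + int (a 1)) = 1" "p + int (a 0) < p + int (a 1)"
    using eq[of "a 0"] eq[of "a 1"] first_gap by (auto simp: base_def)
  have zeros: "y k = 0" if "p + int (a 0) < k" "k < p + int (a 1)" for k
    using eq[of "nat (k - p)"] base_between[of 0 "k - p"] that by simp
  obtain t where t: "p + int (a 1) - (p + int (a 0)) = int (a (Suc t) - a t)"
    "\<And>k. y k = base (k - (p + int (a 0)) + int (a t))"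
    using orbit_closure_adjacent_ones[OF y ones zeros] by blast
  have "int (a (Suc t) - a t) = int (a (Suc 0) - a 0)"
    using t(1) first_gap by (simp add: of_nat_diff)
  then have "t = 0"
    using strict_mono_eq[OF gap_strict_mono, of t 0] by simp
  with t(2) show ?thesis by (auto simp: algebra_simps)
qed

end

section \<open>Marks that encode halting computations\<close>

text \<open>
  The perturbation \<open>2 ^ left t\<close> is at most \<open>2 ^ t\<close>, which is small compared with the growth of the
  main term; so the gaps grow, and each mark is computable because only the single computation coded
  by \<open>t\<close> has to be inspected.
\<close>

definition mark :: "nat \<Rightarrow> nat" where
  "mark t = 4 ^ Suc t + (if accepts (left t) (right t) then 2 ^ left t else 0)"

lemma left_le: "left z \<le> z"
  using le_prod_encode_1[of "left z" "right z"] by simp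

lemma mark_bounds: "4 ^ Suc t \<le> mark t" "mark t \<le> 4 ^ Suc t + 2 ^ t"
  using power_increasing[OF left_le, of "2::nat" t] by (simp_all add: mark_def)

interpretation marks: growing_gaps mark
proof
  have pow: "(2::nat) ^ t \<le> 4 ^ t" for t by (rule power_mono) simp_all
  show "mark 0 < mark 1"
    using mark_bounds[of 0] mark_bounds[of 1] by simp
  \<comment> \<open>With \<open>P = 4 ^ t\<close> the first gap is at most \<open>14 * P\<close> and the second at least \<open>46 * P\<close>.\<close>
  show "mark (Suc t) - mark t < mark (Suc (Suc t)) - mark (Suc t)" for t
    using mark_bounds[of t] mark_bounds[of "Suc t"] mark_bounds[of "Suc (Suc t)"] pow[of t]
      zero_less_power[of "4::nat" t]
    by (simp only: power_Suc) linarith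
qed

lemma recursive_fun_mark [rec_intros]: 
  assumes "recursive_fun a" shows "recursive_fun (\<lambda>x. mark (a x))"
proof -
  have "recursive_fun mark"
    unfolding mark_def[abs_def] by (intro rec_intros decidable_accepts)
  from recursive_fun_comp[OF this assms] show ?thesis .
qed

text \<open>
  The index of a mark is bounded by its value, so that all quantifiers in the description of the
  language are bounded.
\<close>

lemma recursive_orbit_closure: "recursive_subshift marks.orbit_closure"
proof -
  have base: "marks.base (int q - int n + int i) =
      (if n \<le> q + i \<and> (\<exists>t < Suc (q + i - n). q + i - n = mark t) then 1 else 0)" for q n i
  proof -
    have "t \<le> mark t" for t using marks.strict_mono_a by (rule strict_mono_imp_increasing)
    then have "t < Suc (mark t)" for t by (simp add: less_Suc_eq_le)
    then have *: "(\<exists>t < Suc m. m = mark t) \<longleftrightarrow> (\<exists>t. m = mark t)" for m by metis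
    show ?thesis unfolding * 
    proof (cases "n \<le> q + i")
      case True
      then have "int q - int n + int i = int (q + i - n)" by (simp add: of_nat_diff)
      with True show "marks.base (int q - int n + int i) =
          (if n \<le> q + i \<and> (\<exists>t. q + i - n = mark t) then 1 else 0)"
        by (simp add: marks.base_def del: of_nat_diff of_nat_add)
    qed (simp add: marks.base_negative)
  qed
  have "x \<in> list_encode ` language marks.orbit_closure \<longleftrightarrow>
    (\<exists>q < Suc (mark (code_length x) + code_length x). \<forall>i < code_length x.
       code_nth x i = (if code_length x \<le> q + i \<and>
         (\<exists>t < Suc (q + i - code_length x). q + i - code_length x = mark t) then 1 else 0))" for x
  proof -
    obtain w where x: "x = list_encode w" by (metis list_decode_inverse)
    have "x \<in> list_encode ` language marks.orbit_closure \<longleftrightarrow> w \<in> language marks.orbit_closure"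
      by (simp add: x inj_image_mem_iff[OF inj_list_encode])
    moreover have "(\<forall>k < length w. R k = w ! k) \<longleftrightarrow> (\<forall>i < length w. code_nth (list_encode w) i = R i)" for R
      by auto
    ultimately show ?thesis
      unfolding marks.language_orbit_closure_bounded occurs_at_def base x
      by (simp only: code_length less_Suc_eq_le)
  qed
  then show ?thesis
    unfolding recursive_subshift_def recursive_set_iff by (simp only:) (intro rec_intros)
qed

section \<open>The modular halting problem of a recursive subshift\<close>

definition subword_at :: "nat list \<Rightarrow> nat list \<Rightarrow> nat \<Rightarrow> bool" where
  "subword_at w u i \<longleftrightarrow> (\<forall>l < length w. i + l < length u \<and> u ! (i + l) = w ! l)"

lemma funpow_shift_map: "(shift_map ^^ j) x = (\<lambda>i. x (i + int j))"
  by (induction j) (auto simp: shift_map_def algebra_simps)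

text \<open>
  The two cylinders and the time between them are seen in one word of the language which covers
  both sets of coordinates. Conversely a point in which this word occurs can be shifted so that the
  two subwords fall on the required coordinates, by shift invariance.
\<close>

lemma visit_iff_word:
  assumes X: "subshift S X"
  shows "(\<exists>x \<in> X. x \<in> clopen_set (p, C) \<and> (shift_map ^^ j) x \<in> clopen_set (q, D)) \<longleftrightarrow>
    (\<exists>w \<in> set C. \<exists>v \<in> set D. \<exists>u \<in> language X. \<exists>\<alpha> \<beta>.
      subword_at w u \<alpha> \<and> subword_at v u \<beta> \<and> int \<beta> - int \<alpha> = q + int j - p)" (is "?L \<longleftrightarrow> ?R")
proof
  assume ?L
  then obtain x w v where x: "x \<in> X" and wv: "w \<in> set C" "v \<in> set D"
    and w: "\<And>l. l < length w \<Longrightarrow> x (p + int l) = w ! l"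
    and v: "\<And>l. l < length v \<Longrightarrow> x (q + int l + int j) = v ! l"
    by (auto simp: clopen_set_def occurs_at_def funpow_shift_map)
  define lo where "lo = min p (q + int j)"
  define n where "n = nat (max (p + int (length w)) (q + int j + int (length v)) - lo)"
  define u where "u = map (\<lambda>k. x (lo + int k)) [0..<n]"
  have "u \<in> language X" using x occurs_at_window unfolding u_def language_def by blast
  moreover have "subword_at w u (nat (p - lo))"
    unfolding subword_at_def
  proof (intro allI impI)
    fix l assume l: "l < length w"
    have "nat (p - lo) + l < n" "lo + int (nat (p - lo) + l) = p + int l"
      using l unfolding n_def lo_def by linarith+
    then show "nat (p - lo) + l < length u \<and> u ! (nat (p - lo) + l) = w ! l"
      using w[OF l] by (simp add: u_def del: of_nat_add)
  qed
  moreover have "subword_at v u (nat (q + int j - lo))"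
    unfolding subword_at_def
  proof (intro allI impI)
    fix l assume l: "l < length v"
    have "nat (q + int j - lo) + l < n" "lo + int (nat (q + int j - lo) + l) = q + int l + int j"
      using l unfolding n_def lo_def by linarith+
    then show "nat (q + int j - lo) + l < length u \<and> u ! (nat (q + int j - lo) + l) = v ! l"
      using v[OF l] by (simp add: u_def del: of_nat_add)
  qed
  moreover have "int (nat (q + int j - lo)) - int (nat (p - lo)) = q + int j - p"
    unfolding lo_def by linarith
  ultimately show ?R using wv by blast
next
  assume ?R
  then obtain w v u \<alpha> \<beta> where wv: "w \<in> set C" "v \<in> set D" and "u \<in> language X"
    and sub: "subword_at w u \<alpha>" "subword_at v u \<beta>" and dist: "int \<beta> - int \<alpha> = q + int j - p"
    by blast
  then obtain x r where x: "x \<in> X" "\<And>k. k < length u \<Longrightarrow> x (r + int k) = u ! k"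
    by (auto simp: language_def occurs_at_def)
  \<comment> \<open>The subword found at position \<open>r + \<alpha>\<close> of \<open>x\<close> is moved to coordinate \<open>p\<close>.\<close>
  define y where "y = (\<lambda>i. x (i + (r + int \<alpha> - p)))"
  have "y \<in> X" unfolding y_def by (rule subshift_shift_mem[OF X x(1)])
  moreover have "occurs_at w y p"
    unfolding occurs_at_def
  proof (intro allI impI)
    fix l assume "l < length w"
    then have "\<alpha> + l < length u" "u ! (\<alpha> + l) = w ! l" using sub(1) by (auto simp: subword_at_def)
    moreover have "p + int l + (r + int \<alpha> - p) = r + int (\<alpha> + l)" by simp
    ultimately show "y (p + int l) = w ! l" using x(2) unfolding y_def by metis
  qed
  moreover have "occurs_at v ((shift_map ^^ j) y) q"
    unfolding occurs_at_def funpow_shift_map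
  proof (intro allI impI)
    fix l assume "l < length v"
    then have "\<beta> + l < length u" "u ! (\<beta> + l) = v ! l" using sub(2) by (auto simp: subword_at_def)
    moreover have "q + int l + int j + (r + int \<alpha> - p) = r + int (\<beta> + l)" using dist by simp
    ultimately show "y (q + int l + int j) = v ! l" using x(2) unfolding y_def by metis
  qed
  ultimately show ?L using wv unfolding clopen_set_def by auto
qed

text \<open>
  The remaining definitions restate the ingredients of an instance for codes, in terms of functions
  and predicates that are known to be recursive.
\<close>

definition decode_words :: "nat \<Rightarrow> nat list list" where
  "decode_words C = map list_decode (list_decode C)"

lemma encode_decode_words [simp]: "list_encode (map list_encode (decode_words C)) = C"
  by (simp add: decode_words_def comp_def)

lemma code_length_eq: "code_length l = length (list_decode l)"
  using code_length[of "list_decode l"] by simp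

lemma code_nth_eq: "i < code_length l \<Longrightarrow> code_nth l i = list_decode l ! i"
  using code_nth[of i "list_decode l"] by (simp add: code_length_eq)

lemma bex_decode_words:
  "(\<exists>w \<in> set (decode_words C). P w) \<longleftrightarrow> (\<exists>i. i < code_length C \<and> P (list_decode (code_nth C i)))"
proof -
  have "length (decode_words C) = code_length C"
    and "i < code_length C \<Longrightarrow> decode_words C ! i = list_decode (code_nth C i)" for i
    by (simp_all add: decode_words_def code_length_eq code_nth_eq)
  then show ?thesis unfolding Bex_def in_set_conv_nth by auto
qed

definition valid_words_code :: "nat \<Rightarrow> nat \<Rightarrow> bool" where
  "valid_words_code n C \<longleftrightarrow> (\<forall>i < code_length C. code_length (code_nth C i) = n \<and>
     (\<forall>l < code_length (code_nth C i). code_nth (code_nth C i) l \<le> 1))"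

lemma valid_words_code_iff:
  "valid_clopen_code {0, 1} (p, decode_words C) \<longleftrightarrow> (\<exists>n. valid_words_code n C)"
proof -
  have bin: "set (list_decode v) \<subseteq> {0, 1} \<longleftrightarrow> (\<forall>l < code_length v. code_nth v l \<le> 1)" for v
  proof -
    have "set (list_decode v) \<subseteq> {0, 1} \<longleftrightarrow> (\<forall>c \<in> set (list_decode v). c \<le> 1)"
      by (auto simp: le_Suc_eq)
    then show ?thesis by (simp add: all_set_conv_all_nth code_nth_eq flip: code_length_eq)
  qed
  have "(\<forall>w \<in> set (decode_words C). Q w) \<longleftrightarrow> (\<forall>i < code_length C. Q (list_decode (code_nth C i)))" for Q
    using bex_decode_words[of C "\<lambda>w. \<not> Q w"] by blast
  then show ?thesis
    unfolding valid_clopen_code_def valid_words_code_def by (simp only: snd_conv bin code_length_eq)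
qed

definition subword_code_at :: "nat \<Rightarrow> nat \<Rightarrow> nat \<Rightarrow> bool" where
  "subword_code_at w u i \<longleftrightarrow>
     (\<forall>l < code_length w. i + l < code_length u \<and> code_nth u (i + l) = code_nth w l)"

lemma subword_code_at_iff: "subword_code_at w u i \<longleftrightarrow> subword_at (list_decode w) (list_decode u) i"
  unfolding subword_code_at_def subword_at_def
  by (auto simp: code_nth_eq simp flip: code_length_eq)

definition half :: "nat \<Rightarrow> nat" where "half n = (LEAST h. n < 2 * h + 2)"

lemma half: "half (2 * h) = h" "half (Suc (2 * h)) = h"
  unfolding half_def by (rule Least_equality; simp)+

definition pos_part :: "nat \<Rightarrow> nat" where
  "pos_part n = (if n = 2 * half n then half n else 0)"

definition neg_part :: "nat \<Rightarrow> nat" where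
  "neg_part n = (if n = 2 * half n then 0 else Suc (half n))"

lemma int_decode_parts: "int_decode n = int (pos_part n) - int (neg_part n)"
proof (cases "even n")
  case True
  then obtain h where "n = 2 * h" by blast
  then show ?thesis by (simp add: int_decode_def sum_decode_def pos_part_def neg_part_def half)
next
  case False
  then obtain h where h: "n = Suc (2 * h)" using oddE by fastforce
  moreover have "Suc (2 * h) \<noteq> 2 * h" by simp
  ultimately show ?thesis
    by (simp add: int_decode_def sum_decode_def pos_part_def neg_part_def half)
qed

lemma recursive_fun_half: "recursive_fun half"
proof -
  have ex: "\<exists>h. x < 2 * h + 2" for x :: nat by (rule exI[of _ x]) simp
  show ?thesis unfolding half_def[abs_def] by (intro rec_intros ex)
qed

lemma recursive_fun_parts [rec_intros]:
  assumes "recursive_fun a"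
  shows "recursive_fun (\<lambda>x. pos_part (a x))" "recursive_fun (\<lambda>x. neg_part (a x))"
proof -
  have half: "recursive_fun (\<lambda>x. half (a x))" by (rule recursive_fun_comp[OF recursive_fun_half assms])
  show "recursive_fun (\<lambda>x. pos_part (a x))" "recursive_fun (\<lambda>x. neg_part (a x))"
    unfolding pos_part_def neg_part_def by (intro rec_intros assms half)+
qed

lemma encode_instance_mem_iff:
  "encode_instance (c, d, k, m) \<in> modular_halting_problem S X \<longleftrightarrow>
     valid_clopen_code S c \<and> valid_clopen_code S d \<and>
     (\<exists>x \<in> X. \<exists>j. [j = k] (mod m) \<and> x \<in> clopen_set c \<and> (shift_map ^^ j) x \<in> clopen_set d)"
proof -
  have inj: "inj (map list_encode)" by (simp add: inj_list_encode)
  have "(c, d, k, m) = (c', d', k', m')"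
    if "encode_instance (c, d, k, m) = encode_instance (c', d', k', m')" for c' d' k' m'
    using that injD[OF inj] by (cases c; cases d; cases c'; cases d') (auto simp: list_encode_eq int_encode_eq)
  then show ?thesis unfolding modular_halting_problem_def by blast
qed

text \<open>
  An instance and a visit are described by finitely many numbers: the components of the instance, the
  time \<open>j\<close>, the indices of the two words, a word of the language and the two places in it.
\<close>

lemma Sigma01_modular_halting_problem:
  assumes X: "subshift {0, 1} X" and rec: "recursive_subshift X"
  shows "Sigma01 (modular_halting_problem {0, 1} X)"
proof (rule Sigma01I)
  let ?L = "list_encode ` language X"
  have iff: "x \<in> modular_halting_problem {0, 1} X \<longleftrightarrow>
    (\<exists>P C Q D k m. x = list_encode [P, C, Q, D, k, m] \<and>
      (\<exists>n. valid_words_code n C) \<and> (\<exists>n. valid_words_code n D) \<and>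
      (\<exists>j. (\<exists>r s. k + r * m = j + s * m) \<and>
        (\<exists>i. i < code_length C \<and> (\<exists>i'. i' < code_length D \<and> (\<exists>u. u \<in> ?L \<and> (\<exists>\<alpha> \<beta>.
          subword_code_at (code_nth C i) u \<alpha> \<and> subword_code_at (code_nth D i') u \<beta> \<and>
          \<beta> + neg_part Q + pos_part P = \<alpha> + pos_part Q + j + neg_part P))))))" for x
  proof -
    \<comment> \<open>Words of the language are replaced by their codes, integers by differences of naturals.\<close>
    have ex_language: "(\<exists>u \<in> language X. T u) \<longleftrightarrow> (\<exists>u. u \<in> ?L \<and> T (list_decode u))" for T
      by auto
    have dist: "\<beta> + neg_part Q + pos_part P = \<alpha> + pos_part Q + j + neg_part P \<longleftrightarrow>
        int \<beta> - int \<alpha> = int_decode Q + int j - int_decode P" for \<alpha> \<beta> P Q j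
      unfolding int_decode_parts by linarith
    have "x \<in> modular_halting_problem {0, 1} X \<longleftrightarrow>
      (\<exists>P C Q D k m. x = encode_instance ((int_decode P, decode_words C), (int_decode Q, decode_words D), k, m) \<and>
        x \<in> modular_halting_problem {0, 1} X)"
    proof
      assume x: "x \<in> modular_halting_problem {0, 1} X"
      then obtain p C q D k m where c: "x = encode_instance ((p, C), (q, D), k, m)"
        unfolding modular_halting_problem_def by force
      have "decode_words (list_encode (map list_encode E)) = E" for E
        by (simp add: decode_words_def comp_def)
      then have "x = encode_instance ((int_decode (int_encode p), decode_words (list_encode (map list_encode C))),
        (int_decode (int_encode q), decode_words (list_encode (map list_encode D))), k, m)" using c by simp
      with x show "\<exists>P C Q D k m. x = encode_instance ((int_decode P, decode_words C), (int_decode Q, decode_words D), k, m) \<and>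
        x \<in> modular_halting_problem {0, 1} X" by blast
    qed blast
    also have "\<dots> \<longleftrightarrow> (\<exists>P C Q D k m. x = list_encode [P, C, Q, D, k, m] \<and>
        (\<exists>n. valid_words_code n C) \<and> (\<exists>n. valid_words_code n D) \<and>
        (\<exists>j. [j = k] (mod m) \<and> (\<exists>x \<in> X. x \<in> clopen_set (int_decode P, decode_words C) \<and>
          (shift_map ^^ j) x \<in> clopen_set (int_decode Q, decode_words D))))"
    proof -
      have inst: "encode_instance ((int_decode P, decode_words C), (int_decode Q, decode_words D), k, m) =
        list_encode [P, C, Q, D, k, m]" for P C Q D k m by simp
      have mem: "list_encode [P, C, Q, D, k, m] \<in> modular_halting_problem {0, 1} X \<longleftrightarrow>
        (\<exists>n. valid_words_code n C) \<and> (\<exists>n. valid_words_code n D) \<and>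
        (\<exists>j. [j = k] (mod m) \<and> (\<exists>x \<in> X. x \<in> clopen_set (int_decode P, decode_words C) \<and>
          (shift_map ^^ j) x \<in> clopen_set (int_decode Q, decode_words D)))" for P C Q D k m
        unfolding inst[symmetric] encode_instance_mem_iff valid_words_code_iff by blast
      show ?thesis
        unfolding inst by (intro iff_exI conj_cong refl) (erule ssubst, rule mem)
    qed
    finally show ?thesis
      unfolding visit_iff_word[OF X] bex_decode_words cong_iff_lin_nat subword_code_at_iff dist ex_language .
  qed
  have L: "decidable (\<lambda>x. a x \<in> ?L)" if "recursive_fun a" for a
    using decidable_comp[OF _ that] rec unfolding recursive_subshift_def recursive_set_iff .
  show "semidecidable (\<lambda>x. x \<in> modular_halting_problem {0, 1} X)"
    unfolding iff list_encode.simps valid_words_code_def subword_code_at_def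
    by (intro semidecidable_ex semidecidable_conj) ((rule decidable_semidecidable)?, intro rec_intros L)+
qed

section \<open>Hardness of the modular halting problem\<close>

lemma dvd_double_power_4: "n \<le> k \<Longrightarrow> 2 ^ Suc n dvd 2 * (4::nat) ^ k"
proof -
  assume "n \<le> k"
  then have "(2::nat) ^ Suc n dvd 2 ^ Suc k" by (intro le_imp_power_dvd) simp
  moreover have "2 * (4::nat) ^ k = 2 ^ Suc k * 2 ^ k" by (simp flip: power_mult_distrib)
  ultimately show ?thesis by (metis dvd_mult2)
qed

text \<open>
  The origin \<open>2 * 4 ^ n\<close> lies between the marks with index below \<open>n\<close> and the others, and is itself
  divisible by the modulus. So \<open>j\<close> runs through the distances from there to the marks with index at
  least \<open>n\<close>, and modulo \<open>2 ^ Suc n\<close> it is congruent to the perturbation, which is \<open>0\<close> or a power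
  of \<open>2\<close>.
\<close>

lemma visits_mark_iff:
  "(\<exists>t j. j + 2 * 4 ^ n = mark t \<and> [j = 2 ^ n] (mod 2 ^ Suc n)) \<longleftrightarrow> (\<exists>w. accepts n w)"
proof
  assume "\<exists>w. accepts n w"
  then obtain w where w: "accepts n w" by blast
  define t where "t = pair n w"
  have t: "n \<le> t" unfolding t_def by (rule le_prod_encode_1)
  then have "(4::nat) ^ n \<le> 4 ^ t" by (rule power_increasing) simp
  then have le: "2 * (4::nat) ^ n \<le> 4 ^ Suc t" unfolding power_Suc by linarith
  have "(2::nat) ^ Suc n dvd 2 * 4 ^ n" "(2::nat) ^ Suc n dvd 2 * (2 * 4 ^ t)"
    using dvd_double_power_4[of n n] dvd_double_power_4[OF t] dvd_mult by blast+
  then have "(2::nat) ^ Suc n dvd 4 ^ Suc t - 2 * 4 ^ n" by (simp add: dvd_diff_nat)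
  then have "[4 ^ Suc t - 2 * 4 ^ n + 2 ^ n = 2 ^ n] (mod (2::nat) ^ Suc n)"
    unfolding cong_add_rcancel_0_nat cong_0_iff .
  moreover have "4 ^ Suc t - 2 * 4 ^ n + 2 ^ n + 2 * 4 ^ n = mark t"
    using le w by (simp add: mark_def t_def)
  ultimately show "\<exists>t j. j + 2 * 4 ^ n = mark t \<and> [j = 2 ^ n] (mod 2 ^ Suc n)" by blast
next
  assume "\<exists>t j. j + 2 * 4 ^ n = mark t \<and> [j = 2 ^ n] (mod 2 ^ Suc n)"
  then obtain t j where j: "j + 2 * 4 ^ n = mark t" "[j = 2 ^ n] (mod 2 ^ Suc n)" by blast
  have t: "n \<le> t"
  proof (rule ccontr)
    assume "\<not> n \<le> t"
    then have "Suc t \<le> n" by simp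
    then have "(4::nat) ^ Suc t \<le> 4 ^ n" by (rule power_increasing) simp
    moreover have "(2::nat) ^ t \<le> 4 ^ t" by (rule power_mono) simp_all
    moreover have "(0::nat) < 4 ^ t" by simp
    ultimately have "mark t < 2 * 4 ^ n" using mark_bounds(2)[of t] unfolding power_Suc by linarith
    with j(1) show False by linarith
  qed
  define \<delta> :: nat where "\<delta> = (if accepts (left t) (right t) then 2 ^ left t else 0)"
  have "[2 * 4 ^ n = 0] (mod (2::nat) ^ Suc n)"
    unfolding cong_0_iff by (rule dvd_double_power_4) simp
  from cong_add[OF j(2) this] have "[mark t = 2 ^ n] (mod 2 ^ Suc n)" unfolding j(1) by simp
  moreover have "mark t = 2 * (2 * 4 ^ t) + \<delta>" by (simp add: mark_def \<delta>_def)
  moreover have "[2 * (2 * 4 ^ t) = 0] (mod (2::nat) ^ Suc n)"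
    unfolding cong_0_iff using dvd_double_power_4[OF t] dvd_mult by blast
  from cong_add[OF this cong_refl[of \<delta>]] have "[2 * (2 * 4 ^ t) + \<delta> = \<delta>] (mod 2 ^ Suc n)" by simp
  ultimately have "[\<delta> = 2 ^ n] (mod 2 ^ Suc n)" by (metis cong_sym cong_trans)
  then have mod: "\<delta> mod 2 ^ Suc n = 2 ^ n" by (simp add: cong_def)
  have "accepts (left t) (right t)"
    using mod unfolding \<delta>_def by (cases "accepts (left t) (right t)") simp_all
  moreover have "left t = n"
  proof (rule ccontr)
    assume ne: "left t \<noteq> n"
    show False
    proof (cases "left t < n")
      case True
      then have "(2::nat) ^ left t < 2 ^ n" by simp
      with mod calculation show False by (simp add: \<delta>_def)
    next
      case False
      with ne have "Suc n \<le> left t" by simp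
      then have "(2::nat) ^ Suc n dvd 2 ^ left t" by (rule le_imp_power_dvd)
      with mod calculation show False by (simp add: \<delta>_def)
    qed
  qed
  ultimately show "\<exists>w. accepts n w" by blast
qed

text \<open>
  A word reaching up to the second mark, so that it contains exactly the first two 1s.
\<close>

definition marker_word :: "nat list" where
  "marker_word = map (\<lambda>k. marks.base (int k)) [0..<Suc (mark 1)]"

text \<open>
  Placing the marker word at the negative coordinate \<open>- 2 * 4 ^ n\<close> selects the generating point with
  its origin moved to \<open>2 * 4 ^ n\<close>, without any computation of marks in the reduction.
\<close>

definition halting_instance :: "nat \<Rightarrow> nat" where
  "halting_instance n =
     encode_instance ((- int (2 * 4 ^ n), [marker_word]), (0, [[1]]), 2 ^ n, 2 ^ Suc n)"

lemma halting_instance_iff: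
  "halting_instance n \<in> modular_halting_problem {0, 1} marks.orbit_closure \<longleftrightarrow> (\<exists>w. accepts n w)"
proof -
  have bin: "marks.base i \<in> {0, 1}" for i using marks.base_01[of i] by blast
  have "set marker_word \<subseteq> {0, 1}"
    unfolding marker_word_def set_map by (rule image_subsetI) (rule bin)
  then have valid: "valid_clopen_code {0, 1} (p, [marker_word])" "valid_clopen_code {0, 1} (q, [[1]])" for p q
    by (auto simp: valid_clopen_code_def)
  have visit: "(\<exists>x \<in> marks.orbit_closure. \<exists>j. Q j \<and> x \<in> clopen_set (- int N, [marker_word]) \<and>
      (shift_map ^^ j) x \<in> clopen_set (0, [[1]])) \<longleftrightarrow> (\<exists>t j. j + N = mark t \<and> Q j)" (is "?L \<longleftrightarrow> ?R") for Q N
  proof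
    assume ?L
    then obtain x j where x: "x \<in> marks.orbit_closure" "Q j" "occurs_at marker_word x (- int N)" "x (int j) = 1"
      by (auto simp: clopen_set_def occurs_at_def funpow_shift_map)
    have "x = (\<lambda>k. marks.base (k - (- int N)))"
      using marks.prefix_occurrence[OF x(1)] x(3) unfolding marker_word_def by blast
    with x(4) obtain t where "int j + int N = int (mark t)" using marks.base_eq_1 by auto
    then have "j + N = mark t" by linarith
    with x(2) show ?R by blast
  next
    assume ?R
    then obtain t j where tj: "j + N = mark t" "Q j" by blast
    define x where "x = (\<lambda>k. marks.base (k + int N))"
    have "x \<in> marks.orbit_closure"
      unfolding x_def by (rule subshift_shift_mem[OF marks.subshift_orbit_closure marks.base_in_orbit_closure])
    moreover have "occurs_at marker_word x (- int N)"
      by (simp add: occurs_at_def marker_word_def x_def del: upt_Suc)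
    moreover have "x (int j) = 1"
      unfolding x_def marks.base_eq_1 using tj(1) by (metis of_nat_add)
    ultimately show ?L using tj(2) by (auto simp: clopen_set_def occurs_at_def funpow_shift_map)
  qed
  show ?thesis
    unfolding halting_instance_def encode_instance_mem_iff visit visits_mark_iff using valid by blast
qed

lemma recursive_fun_halting_instance: "recursive_fun halting_instance"
proof -
  have "int_encode (- int N) = 2 * N - 1" if "0 < N" for N
    using that by (cases N) (simp_all add: int_encode_def sum_encode_def)
  from this[of "2 * 4 ^ n" for n]
  have "halting_instance n = list_encode [2 * (2 * 4 ^ n) - 1, list_encode [list_encode marker_word],
      int_encode 0, list_encode [list_encode [1]], 2 ^ n, 2 ^ Suc n]" for n
    unfolding halting_instance_def encode_instance.simps by simp
  then have eq: "halting_instance = (\<lambda>n. list_encode [2 * (2 * 4 ^ n) - 1, list_encode [list_encode marker_word],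
      int_encode 0, list_encode [list_encode [1]], 2 ^ n, 2 ^ Suc n])" by (rule ext)
  show ?thesis unfolding eq list_encode.simps by (intro rec_intros)
qed

lemma modular_halting_problem_hard:
  assumes "Sigma01 B"
  shows "many_one_reducible B (modular_halting_problem {0, 1} marks.orbit_closure)"
proof -
  obtain e where e: "\<And>x. x \<in> B \<longleftrightarrow> (\<exists>w. accepts (pair e x) w)" using Sigma01_accepts[OF assms] by blast
  have "recursive_fun (\<lambda>x. halting_instance (pair e x))"
    by (rule recursive_fun_comp[OF recursive_fun_halting_instance]) (intro rec_intros)
  with e show ?thesis unfolding many_one_reducible_def halting_instance_iff[symmetric] by blast
qed

theorem theorem4:
  "\<exists>X :: (int \<Rightarrow> nat) set.
     subshift {0, 1} X \<and> recursive_subshift X \<and> countable X \<and> weakly_transitive X \<and>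
     quasiminimal {0, 1} X \<and>
     Sigma01_complete (modular_halting_problem {0, 1} X) \<and>
     {Y. subshift {0, 1} Y \<and> Y \<subset> X \<and> Y \<noteq> {}} =
       {lang_inv {0, 1} {replicate a 0 @ [1] @ replicate b 0 | a b. True},
        lang_inv {0, 1} {replicate a 0 | a. True}}"
proof (intro exI[of _ marks.orbit_closure] conjI)
  have "{Y. subshift {0, 1} Y \<and> Y \<subset> marks.orbit_closure} \<subseteq> insert {} {at_most_one, {zero_point}}"
    unfolding marks.proper_subsystems_orbit_closure[symmetric] by blast
  then have "finite {Y. subshift {0, 1} Y \<and> Y \<subset> marks.orbit_closure}" by (rule finite_subset) simp
  then show "quasiminimal {0, 1} marks.orbit_closure"
    using marks.subshift_orbit_closure by (simp add: quasiminimal_def)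
  show "Sigma01_complete (modular_halting_problem {0, 1} marks.orbit_closure)"
    unfolding Sigma01_complete_def
    using Sigma01_modular_halting_problem[OF marks.subshift_orbit_closure recursive_orbit_closure]
      modular_halting_problem_hard by blast
  show "{Y. subshift {0, 1} Y \<and> Y \<subset> marks.orbit_closure \<and> Y \<noteq> {}} =
       {lang_inv {0, 1} {replicate a 0 @ [1] @ replicate b 0 | a b. True},
        lang_inv {0, 1} {replicate a 0 | a. True}}"
    unfolding lang_inv_eq[OF subshift_at_most_one language_at_most_one]
      lang_inv_eq[OF subshift_zero_point language_zero_point]
    by (rule marks.proper_subsystems_orbit_closure)
qed (rule marks.subshift_orbit_closure recursive_orbit_closure marks.countable_orbit_closure
      marks.weakly_transitive_orbit_closure)+

end
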